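(* Let $m$ be a positive integer, let $u,\sigma_1,\ldots,\sigma_m$ be weights on $\mathbb{R}^n$, let $1<p_1,\ldots,p_m<\infty$, let $p$ be defined by $\frac1p=\sum_{i=1}^m\frac1{p_i}$, and write $\vec{p}=(p_1,\ldots,p_m)$, $\vec{\sigma}=(\sigma_1,\ldots,\sigma_m)$. If $\sigma_i\in A_\infty$ for each $1\le i\le m$ and $(u,\vec{\sigma})\in S_{\vec{p}}$, then there is a constant $C$ such that for all $f_i\in L^{p_i}(\sigma_i)$, $1\le i\le m$, $$\|\mathcal{M}(f_1\sigma_1,\ldots,f_m\sigma_m)\|_{L^p(u)}\leq C\prod_{i=1}^m\|f_i\|_{L^{p_i}(\sigma_i)}.$$
   Context: A weight is a measurable function on $\mathbb{R}^n$ that is positive and finite almost everywhere. All cubes have sides parallel to the coordinate axes. For a weight $v$ and $0<q<\infty$, $\|f\|_{L^q(v)}=\left(\int_{\mathbb{R}^n}|f|^q v\,dx\right)^{1/q}$, and $v(Q)=\int_Q v\,dx$. For $1<q<\infty$, $q'=\frac{q}{q-1}$. For $1<q<\infty$, a weight $v$ is in $A_q$ if $$\sup_Q\left(\frac{1}{|Q|}\int_Q v\,dx\right)\left(\frac{1}{|Q|}\int_Q v^{1-q'}\,dx\right)^{q-1}<\infty,$$ the supremum being over all cubes $Q\subset\mathbb{R}^n$, and $A_\infty=\bigcup_{1<q<\infty}A_q$. The multilinear maximal operator is defined for $\vec{f}=(f_1,\ldots,f_m)$ by $$\mathcal{M}(\vec{f})(x)=\sup_{Q\ni x}\prod_{i=1}^m\left(\frac{1}{|Q|}\int_Q|f_i(y_i)|\,dy_i\right),$$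 the supremum being over all cubes $Q$ containing $x$. The pair $(u,\vec{\sigma})$ satisfies the testing condition $S_{\vec{p}}$, written $(u,\vec\sigma)\in S_{\vec p}$, if there exists a constant $C$ such that for all cubes $Q$, $$\left(\int_Q\mathcal{M}(\sigma_1\chi_Q,\ldots,\sigma_m\chi_Q)^p\,u\,dx\right)^{\frac1p}\leq C\prod_{i=1}^m\sigma_i(Q)^{\frac1{p_i}}.$$ *)

theory Defs
  imports "HOL-Analysis.Analysis"
begin

text \<open>
  Functions on \<open>\<real>\<^sup>n\<close> are extended-real valued, so that a weight may be infinite (or
  nonpositive) on a null set; measurability is Lebesgue measurability, and integrals of
  nonnegative functions are taken in \<open>[0, \<infinity>]\<close>.
\<close>

text \<open>
  Real powers on \<open>[0, \<infinity>]\<close>; for \<open>a < 0\<close>, \<open>0\<close> and \<open>\<infinity>\<close> are exchanged. The library's \<open>powr\<close>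
  on the reals has \<open>0 powr a = 0\<close> also for \<open>a \<le> 0\<close>.
\<close>

definition enn_powr :: "ennreal \<Rightarrow> real \<Rightarrow> ennreal"  (infixr "powre" 80) where
  "x powre a =
    (if a = 0 then 1
     else if x = 0 then (if a > 0 then 0 else \<infinity>)
     else if x = \<infinity> then (if a > 0 then \<infinity> else 0)
     else ennreal (enn2real x powr a))"

definition weight :: "(real ^ 'n \<Rightarrow> ereal) \<Rightarrow> bool" where
  "weight v \<longleftrightarrow> v \<in> borel_measurable lebesgue \<and> (AE x in lebesgue. 0 < v x \<and> v x < \<infinity>)"

text \<open>
  Cubes are nondegenerate and closed. Averages do not see the boundary, and by enlarging
  cubes slightly the supremum defining the maximal operator is the same for open cubes.
\<close>

definition cubes :: "(real ^ 'n) set set" where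
  "cubes = {cbox a (a + (\<chi> i. l)) | a l. 0 < l}"

definition average :: "(real ^ 'n) set \<Rightarrow> (real ^ 'n \<Rightarrow> ennreal) \<Rightarrow> ennreal" where
  "average Q g = (\<integral>\<^sup>+y\<in>Q. g y \<partial>lebesgue) / emeasure lebesgue Q"

definition weight_measure :: "(real ^ 'n \<Rightarrow> ereal) \<Rightarrow> (real ^ 'n) set \<Rightarrow> ennreal" where
  "weight_measure v Q = (\<integral>\<^sup>+x\<in>Q. e2ennreal (v x) \<partial>lebesgue)"

definition Lnorm :: "real \<Rightarrow> (real ^ 'n \<Rightarrow> ereal) \<Rightarrow> (real ^ 'n \<Rightarrow> ereal) \<Rightarrow> ennreal" where
  "Lnorm q v f =
    (\<integral>\<^sup>+x. (e2ennreal \<bar>f x\<bar> powre q) * e2ennreal (v x) \<partial>lebesgue) powre (1 / q)"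

definition Lspace :: "real \<Rightarrow> (real ^ 'n \<Rightarrow> ereal) \<Rightarrow> (real ^ 'n \<Rightarrow> ereal) set" where
  "Lspace q v = {f. f \<in> borel_measurable lebesgue \<and> Lnorm q v f < \<infinity>}"

definition conjugate_exponent :: "real \<Rightarrow> real" where
  "conjugate_exponent q = q / (q - 1)"

definition A_class :: "real \<Rightarrow> (real ^ 'n \<Rightarrow> ereal) set" where
  "A_class q = {v. weight v \<and>
    (SUP Q\<in>cubes.
       average Q (\<lambda>x. e2ennreal (v x)) *
       (average Q (\<lambda>x. e2ennreal (v x) powre (1 - conjugate_exponent q)) powre (q - 1))) < \<infinity>}"

definition A_infinity :: "(real ^ 'n \<Rightarrow> ereal) set" where
  "A_infinity = (\<Union>q\<in>{1<..}. A_class q)"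

text \<open>Vectors of \<open>m\<close> functions or exponents are indexed by \<open>{1..m}\<close>.\<close>

definition multilinear_maximal ::
    "nat \<Rightarrow> (nat \<Rightarrow> real ^ 'n \<Rightarrow> ereal) \<Rightarrow> real ^ 'n \<Rightarrow> ereal" where
  "multilinear_maximal m f x =
    enn2ereal (SUP Q\<in>{Q \<in> cubes. x \<in> Q}. \<Prod>i=1..m. average Q (\<lambda>y. e2ennreal \<bar>f i y\<bar>))"

definition testing_condition ::
    "nat \<Rightarrow> real \<Rightarrow> (nat \<Rightarrow> real) \<Rightarrow> (real ^ 'n \<Rightarrow> ereal) \<Rightarrow> (nat \<Rightarrow> real ^ 'n \<Rightarrow> ereal) \<Rightarrow> bool"
  where
  "testing_condition m p ps u \<sigma> \<longleftrightarrow>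
    (\<exists>C::real. \<forall>Q\<in>cubes.
      (\<integral>\<^sup>+x\<in>Q. (e2ennreal (multilinear_maximal m (\<lambda>i y. \<sigma> i y * indicator Q y) x) powre p)
                 * e2ennreal (u x) \<partial>lebesgue) powre (1 / p)
      \<le> ennreal C * (\<Prod>i=1..m. weight_measure (\<sigma> i) Q powre (1 / ps i)))"

end

theory Submission
  imports Defs
begin

text \<open>
  Bounding the maximal function in the testing condition from below on \<open>Q\<close> by the product of the
  averages of the \<open>\<sigma>\<^sub>i\<close> over \<open>Q\<close> turns the condition into an inequality of Muckenhoupt type,
  \<open>u(Q) (\<Prod>\<^sub>i \<sigma>\<^sub>i(Q) / |Q|)\<^sup>p \<le> C (\<Prod>\<^sub>i \<sigma>\<^sub>i(Q)\<^bsup>1/p\<^sub>i\<^esup>)\<^sup>p\<close>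
  (lemma \<open>testing_condition_average\<close>). For weights in \<open>A\<^sub>\<infinity>\<close> this gives the theorem, since the mass
  of a cube is comparable to the mass of each subset filling a fixed proportion of it
  (lemma \<open>A_infinity_large_subset\<close>); in particular the \<open>\<sigma>\<^sub>i\<close> are doubling.

  Suppose that the maximal function of \<open>(f\<^sub>i \<sigma>\<^sub>i)\<close> is dominated by products of averages over a sparse
  family of cubes, each cube \<open>P\<close> containing a set \<open>E\<^sub>P\<close> of at least half of its volume, with the sets
  \<open>E\<^sub>P\<close> pairwise disjoint. The average of \<open>f\<^sub>i \<sigma>\<^sub>i\<close> over \<open>P\<close> is the \<open>\<sigma>\<^sub>i\<close>-weighted average \<open>A\<^sub>i\<close> of \<open>f\<^sub>i\<close> times
  \<open>\<sigma>\<^sub>i(P) / |P|\<close>. The inequality above therefore bounds the contribution of \<open>P\<close> to the integral by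
  a constant times \<open>\<Prod>\<^sub>i (A\<^sub>i\<^bsup>p\<^sub>i\<^esup> \<sigma>\<^sub>i(P))\<^bsup>p/p\<^sub>i\<^esup>\<close>, where \<open>\<sigma>\<^sub>i(P)\<close> may be replaced by \<open>\<sigma>\<^sub>i(E\<^sub>P)\<close>. Hoelder's
  inequality for the sum over \<open>P\<close> (lemma \<open>Holder_sum_prod\<close>) leaves, for each \<open>i\<close>, the sum of
  \<open>A\<^sub>i\<^bsup>p\<^sub>i\<^esup> \<sigma>\<^sub>i(E\<^sub>P)\<close>. As the \<open>E\<^sub>P\<close> are disjoint, this is controlled by the maximal operator of the doubling
  measure \<open>\<sigma>\<^sub>i dx\<close>, which is bounded on \<open>L\<^bsup>p\<^sub>i\<^esup>(\<sigma>\<^sub>i)\<close> (lemma \<open>maximal_sum_bound\<close>).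

  The sparse family is obtained without dyadic grids, for a finite family of cubes at a time.
  Each cube is first enlarged to one whose product average at most doubles under tripling
  (lemma \<open>near_maximal_cube\<close>); a greedy selection by decreasing size then plays the role of the
  stopping cubes, and Vitali's covering lemma gives the sparseness (lemma \<open>sparse_selection\<close>). The
  averages over the selected cubes dominate the maximal function on the tripled cubes, so
  it is over these that the averages in the argument above are taken. The constants do not depend on
  the finite family, and monotone convergence along the countable family of rational cubes gives
  the full maximal operator.
\<close>

section \<open>Powers of extended nonnegative reals\<close>

lemma enn_powr_0 [simp]: "0 < a \<Longrightarrow> 0 powre a = 0"
  by (simp add: enn_powr_def)

lemma enn_powr_top [simp]: "0 < a \<Longrightarrow> top powre a = top"
  by (simp add: enn_powr_def)

lemma enn_powr_1 [simp]: "1 powre a = 1"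
  by (simp add: enn_powr_def)

lemma enn_powr_exponent_1 [simp]: "x powre 1 = x"
  by (cases x) (auto simp: enn_powr_def)

lemma enn_powr_ennreal: "0 < a \<Longrightarrow> 0 \<le> r \<Longrightarrow> ennreal r powre a = ennreal (r powr a)"
  by (auto simp: enn_powr_def)

lemma enn_powr_mono:
  assumes "0 < a" "x \<le> y" shows "x powre a \<le> y powre a"
proof (cases x)
  case (real r)
  show ?thesis
    using assms real by (cases y) (auto simp: enn_powr_ennreal powr_mono2)
qed (use assms in \<open>auto simp: top_unique\<close>)

lemma enn_powr_mult:
  assumes "0 < a" shows "(x * y) powre a = x powre a * y powre a"
proof (cases x)
  case (real r)
  show ?thesis
  proof (cases y)
    case (real s)
    with \<open>x = ennreal r\<close> \<open>0 \<le> r\<close> show ?thesis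
      using assms by (simp add: enn_powr_ennreal powr_mult flip: ennreal_mult)
  next
    case top
    with real assms show ?thesis
      by (cases "r = 0") (auto simp: ennreal_mult_top enn_powr_ennreal)
  qed
next
  case top
  show ?thesis
  proof (cases y)
    case (real r)
    with top assms show ?thesis
      by (cases "r = 0") (auto simp: ennreal_top_mult enn_powr_ennreal)
  qed (use top assms in auto)
qed

lemma enn_powr_powr:
  assumes "0 < a" "0 < b" shows "(x powre a) powre b = x powre (a * b)"
  using assms by (cases x) (auto simp: enn_powr_ennreal powr_powr)

lemma enn_powr_prod:
  assumes "0 < a" shows "(\<Prod>i\<in>I. f i) powre a = (\<Prod>i\<in>I. f i powre a)"
  by (induction I rule: infinite_finite_induct) (simp_all add: enn_powr_mult assms)

text \<open>
  Raising to a positive power is an order automorphism of \<open>[0, \<infinity>]\<close>; this form moves the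
  power off a supremum.
\<close>

lemma enn_powr_le_iff:
  assumes "0 < a" shows "x powre a \<le> y \<longleftrightarrow> x \<le> y powre (1 / a)"
proof
  assume "x powre a \<le> y"
  then have "(x powre a) powre (1 / a) \<le> y powre (1 / a)"
    using assms by (intro enn_powr_mono) auto
  then show "x \<le> y powre (1 / a)"
    using assms by (simp add: enn_powr_powr)
next
  assume "x \<le> y powre (1 / a)"
  then have "x powre a \<le> (y powre (1 / a)) powre a"
    using assms by (intro enn_powr_mono) auto
  then show "x powre a \<le> y"
    using assms by (simp add: enn_powr_powr)
qed

lemma enn_powr_eq_0_iff [simp]: "0 < a \<Longrightarrow> x powre a = 0 \<longleftrightarrow> x = 0"
  by (auto simp: enn_powr_def ennreal_eq_0_iff enn2real_eq_0_iff)

lemma enn_powr_eq_top_iff [simp]: "0 < a \<Longrightarrow> x powre a = top \<longleftrightarrow> x = top"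
  by (auto simp: enn_powr_def)

lemma measurable_enn_powr [measurable]:
  assumes [measurable]: "f \<in> borel_measurable M"
  shows "(\<lambda>x. f x powre a) \<in> borel_measurable M"
  unfolding enn_powr_def by measurable

lemma ennreal_prod:
  "(\<And>i. i \<in> I \<Longrightarrow> 0 \<le> f i) \<Longrightarrow> ennreal (\<Prod>i\<in>I. f i) = (\<Prod>i\<in>I. ennreal (f i))"
  by (simp add: prod_ennreal)

lemma prod_ennreal_mono:
  fixes f g :: "'a \<Rightarrow> ennreal"
  assumes "\<And>i. i \<in> I \<Longrightarrow> f i \<le> g i" shows "(\<Prod>i\<in>I. f i) \<le> (\<Prod>i\<in>I. g i)"
  using assms by (induction I rule: infinite_finite_induct) (auto intro: mult_mono)

section \<open>Hoelder's inequality for finite sums of products\<close>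

text \<open>
  Jensen's inequality for \<open>exp\<close> at the points \<open>ln (x i)\<close>.
\<close>

lemma weighted_arith_geom_mean:
  fixes x \<theta> :: "'a \<Rightarrow> real"
  assumes "finite I" "\<And>i. i \<in> I \<Longrightarrow> 0 < \<theta> i" "\<And>i. i \<in> I \<Longrightarrow> 0 \<le> x i" "(\<Sum>i\<in>I. \<theta> i) = 1"
  shows "(\<Prod>i\<in>I. x i powr \<theta> i) \<le> (\<Sum>i\<in>I. \<theta> i * x i)"
proof (cases "\<exists>i\<in>I. x i = 0")
  case True
  then have "(\<Prod>i\<in>I. x i powr \<theta> i) = 0"
    using assms(1) by (intro prod_zero) auto
  moreover have "0 \<le> (\<Sum>i\<in>I. \<theta> i * x i)"
    using assms by (intro sum_nonneg) (auto simp: less_imp_le)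
  ultimately show ?thesis
    by simp
next
  case False
  then have pos: "0 < x i" if "i \<in> I" for i
    using assms(3)[OF that] that by force
  have "I \<noteq> {}"
    using assms(4) by auto
  have "(\<Prod>i\<in>I. x i powr \<theta> i) = exp (\<Sum>i\<in>I. \<theta> i * ln (x i))"
    using assms(1) pos by (simp add: exp_sum powr_def) (intro prod.cong; force)
  also have "\<dots> \<le> (\<Sum>i\<in>I. \<theta> i * exp (ln (x i)))"
    using convex_on_sum[OF \<open>finite I\<close> \<open>I \<noteq> {}\<close> exp_convex assms(4), of "\<lambda>i. ln (x i)"] assms(2)
    by (auto simp: less_imp_le)
  also have "\<dots> = (\<Sum>i\<in>I. \<theta> i * x i)"
    using pos by (intro sum.cong) auto
  finally show ?thesis .
qed

text \<open>
  Dividing each \<open>a i\<close> by its sum over \<open>T\<close> reduces the claim to the weighted inequality between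
  the arithmetic and geometric means, applied for each \<open>P\<close> and summed. The exponents
  \<open>\<theta> i = p / ps i\<close> of the theorem add up to \<open>1\<close> exactly because \<open>1 / p\<close> is the sum of the
  \<open>1 / ps i\<close>.
\<close>

lemma Holder_sum_prod:
  fixes a :: "'i \<Rightarrow> 'b \<Rightarrow> ennreal" and \<theta> :: "'i \<Rightarrow> real"
  assumes I: "finite I" "\<And>i. i \<in> I \<Longrightarrow> 0 < \<theta> i" "(\<Sum>i\<in>I. \<theta> i) = 1" and "finite T"
  shows "(\<Sum>P\<in>T. \<Prod>i\<in>I. a i P powre \<theta> i) \<le> (\<Prod>i\<in>I. (\<Sum>P\<in>T. a i P) powre \<theta> i)"
proof -
  define A where "A i = (\<Sum>P\<in>T. a i P)" for i
  consider "\<exists>i\<in>I. A i = 0" | "\<forall>i\<in>I. A i \<noteq> 0" "\<exists>i\<in>I. A i = top" | "\<forall>i\<in>I. A i \<noteq> 0 \<and> A i \<noteq> top"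
    by blast
  then show ?thesis
  proof cases
    case 1
    then obtain i where i: "i \<in> I" "A i = 0" by blast
    then have "(\<Prod>i\<in>I. a i P powre \<theta> i) = 0" if "P \<in> T" for P
      using I \<open>finite T\<close> that unfolding A_def by (intro prod_zero) auto
    then have "(\<Sum>P\<in>T. \<Prod>i\<in>I. a i P powre \<theta> i) = 0"
      by (intro sum.neutral) blast
    then show ?thesis by simp
  next
    case 2
    have "(\<Prod>i\<in>I. A i powre \<theta> i) = top"
      using 2 I by (auto simp: ennreal_prod_eq_top)
    then show ?thesis
      by (simp add: A_def)
  next
    case 3
    define b where "b i P = enn2real (a i P)" for i P
    define B where "B i = enn2real (A i)" for i
    have A: "A i = ennreal (B i)" "0 < B i" if "i \<in> I" for i
      using 3 that by (auto simp: B_def less_top enn2real_positive_iff zero_less_iff_neq_zero)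
    have a: "a i P = ennreal (b i P)" "0 \<le> b i P" if "i \<in> I" "P \<in> T" for i P
    proof -
      have "a i P \<le> A i"
        unfolding A_def by (rule member_le_sum) (use that \<open>finite T\<close> in auto)
      then show "a i P = ennreal (b i P)"
        using 3 that le_less_trans[of "a i P" "A i" top] by (simp add: b_def less_top)
    qed (simp add: b_def)
    have B_sum: "(\<Sum>P\<in>T. b i P) = B i" if "i \<in> I" for i
    proof -
      have "ennreal (\<Sum>P\<in>T. b i P) = ennreal (B i)"
        using that a A by (simp add: A_def[symmetric] flip: sum_ennreal) (simp add: A_def)
      then show ?thesis
        using A[OF that] a that by (subst (asm) ennreal_inj) (auto intro: sum_nonneg)
    qed
    have "(\<Prod>i\<in>I. b i P powr \<theta> i) \<le> (\<Prod>i\<in>I. B i powr \<theta> i) * (\<Sum>i\<in>I. \<theta> i * (b i P / B i))"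
      if "P \<in> T" for P
    proof -
      have "(\<Prod>i\<in>I. b i P powr \<theta> i) = (\<Prod>i\<in>I. B i powr \<theta> i) * (\<Prod>i\<in>I. (b i P / B i) powr \<theta> i)"
        unfolding prod.distrib[symmetric]
        using a(2) A(2) that by (intro prod.cong) (force simp: powr_divide less_imp_le)+
      also have "\<dots> \<le> (\<Prod>i\<in>I. B i powr \<theta> i) * (\<Sum>i\<in>I. \<theta> i * (b i P / B i))"
        using I a(2) A that
        by (intro mult_left_mono weighted_arith_geom_mean prod_nonneg) (auto simp: less_imp_le)
      finally show ?thesis .
    qed
    then have "(\<Sum>P\<in>T. \<Prod>i\<in>I. b i P powr \<theta> i)
        \<le> (\<Sum>P\<in>T. (\<Prod>i\<in>I. B i powr \<theta> i) * (\<Sum>i\<in>I. \<theta> i * (b i P / B i)))"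
      by (rule sum_mono)
    also have "\<dots> = (\<Prod>i\<in>I. B i powr \<theta> i) * (\<Sum>i\<in>I. \<theta> i * ((\<Sum>P\<in>T. b i P) / B i))"
      by (subst sum_distrib_left[symmetric], subst sum.swap)
         (simp add: sum_distrib_left sum_divide_distrib)
    also have "(\<Sum>i\<in>I. \<theta> i * ((\<Sum>P\<in>T. b i P) / B i)) = (\<Sum>i\<in>I. \<theta> i)"
      using A B_sum by (intro sum.cong) force+
    finally have "(\<Sum>P\<in>T. \<Prod>i\<in>I. b i P powr \<theta> i) \<le> (\<Prod>i\<in>I. B i powr \<theta> i)"
      by (simp add: I)
    then have "ennreal (\<Sum>P\<in>T. \<Prod>i\<in>I. b i P powr \<theta> i) \<le> ennreal (\<Prod>i\<in>I. B i powr \<theta> i)"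
      by (rule ennreal_leI)
    also have "ennreal (\<Prod>i\<in>I. B i powr \<theta> i) = (\<Prod>i\<in>I. A i powre \<theta> i)"
      using A I by (subst ennreal_prod) (auto intro!: prod.cong simp: enn_powr_ennreal less_imp_le)
    also have "ennreal (\<Sum>P\<in>T. \<Prod>i\<in>I. b i P powr \<theta> i) = (\<Sum>P\<in>T. \<Prod>i\<in>I. a i P powre \<theta> i)"
      using a I by (subst sum_ennreal[symmetric])
        (auto intro!: sum.cong prod.cong prod_nonneg simp: ennreal_prod enn_powr_ennreal)
    finally show ?thesis
      by (simp add: A_def)
  qed
qed

section \<open>Cubes and their triples\<close>

text \<open>
  The simplifier would rewrite Lebesgue measure of a cube to Borel measure of its main part.
\<close>

declare emeasure_completion [simp del]

definition cube :: "real ^ 'n \<Rightarrow> real \<Rightarrow> (real ^ 'n) set" where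
  "cube a l = cbox a (a + (\<chi> i. l))"

lemma mem_cube: "x \<in> cube a l \<longleftrightarrow> (\<forall>i. a $ i \<le> x $ i \<and> x $ i \<le> a $ i + l)"
  by (simp add: cube_def mem_box_cart)

lemma cubesE:
  assumes "Q \<in> cubes" obtains a l where "Q = cube a l" "0 < l"
  using assms by (auto simp: cubes_def cube_def)

lemma cube_in_cubes: "0 < l \<Longrightarrow> cube a l \<in> cubes"
  by (auto simp: cubes_def cube_def)

lemma sets_cube [measurable]: "Q \<in> cubes \<Longrightarrow> Q \<in> sets lebesgue"
  by (auto simp: cubes_def)

lemma emeasure_cube:
  fixes a :: "real ^ 'n"
  assumes "0 \<le> l" shows "emeasure lebesgue (cube a l) = ennreal (l ^ CARD('n))"
proof -
  have "a \<in> cube a l"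
    using assms by (simp add: mem_cube)
  then have "measure lborel (cube a l) = l ^ CARD('n)"
    by (subst cube_def, subst content_cbox_cart) (auto simp: cube_def)
  then show ?thesis
    using emeasure_lborel_cbox_finite[of a "a + (\<chi> i. l)"]
    by (simp add: cube_def emeasure_eq_ennreal_measure emeasure_completion)
qed

text \<open>
  The choice is unique, since the side length of a cube is determined by its volume.
\<close>

definition side :: "(real ^ 'n) set \<Rightarrow> real" where
  "side Q = (SOME l. 0 < l \<and> (\<exists>a. Q = cube a l))"

text \<open>
  For a cube this is the concentric cube of three times the side, expressed without a choice
  of a centre and a side length.
\<close>

definition triple :: "(real ^ 'n) set \<Rightarrow> (real ^ 'n) set" where
  "triple Q = {x + (y - z) | x y z. x \<in> Q \<and> y \<in> Q \<and> z \<in> Q}"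

lemma triple_cube:
  fixes a :: "real ^ 'n"
  assumes "0 < l" shows "triple (cube a l) = cube (a - (\<chi> i. l)) (3 * l)"
proof (intro set_eqI iffI)
  fix w assume "w \<in> triple (cube a l)"
  then obtain x y z where "w = x + (y - z)" "x \<in> cube a l" "y \<in> cube a l" "z \<in> cube a l"
    by (auto simp: triple_def)
  moreover from this have "x $ i \<le> a $ i + l \<and> a $ i \<le> x $ i" "y $ i \<le> a $ i + l \<and> a $ i \<le> y $ i"
    "z $ i \<le> a $ i + l \<and> a $ i \<le> z $ i" for i
    by (auto simp: mem_cube)
  ultimately show "w \<in> cube (a - (\<chi> i. l)) (3 * l)"
    unfolding mem_cube by (simp, smt (verit))
next
  fix w assume w: "w \<in> cube (a - (\<chi> i. l)) (3 * l)"
  \<comment> \<open>\<open>x\<close> is the image of \<open>w\<close> under the contraction of the large cube onto the small one; every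
    coordinate of \<open>w - x\<close> is then at most \<open>l\<close> in absolute value, and is written as a
    difference of two points by taking positive and negative parts.\<close>
  define x :: "real ^ 'n" where "x = (\<chi> i. a $ i + (w $ i - a $ i + l) / 3)"
  define y :: "real ^ 'n" where "y = (\<chi> i. max (a $ i) (min (a $ i + l) (a $ i + (w $ i - x $ i))))"
  define z :: "real ^ 'n" where "z = (\<chi> i. a $ i + max 0 (- (w $ i - x $ i)))"
  have "a $ i - l \<le> w $ i \<and> w $ i \<le> a $ i - l + 3 * l" for i
    using w unfolding mem_cube by simp
  then have bd: "a $ i - l \<le> w $ i" "w $ i \<le> a $ i + 2 * l" for i
    by (smt (verit))+
  have "x \<in> cube a l"
    using bd assms by (auto simp: mem_cube x_def field_simps)
  moreover have "y \<in> cube a l"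
    using assms by (auto simp: mem_cube y_def)
  moreover have "z \<in> cube a l"
  proof -
    have "- (w $ i - x $ i) \<le> l" for i
      using bd[of i] assms by (simp add: x_def field_simps)
    then show ?thesis
      using assms by (auto simp: mem_cube z_def)
  qed
  moreover have "w = x + (y - z)"
  proof (intro vec_eq_iff[THEN iffD2] allI)
    fix i
    have "w $ i - x $ i \<le> l" "- l \<le> w $ i - x $ i"
      using bd[of i] assms by (simp_all add: x_def field_simps)
    then show "w $ i = (x + (y - z)) $ i"
      using assms by (simp add: y_def z_def)
  qed
  ultimately show "w \<in> triple (cube a l)"
    unfolding triple_def by blast
qed

lemma side_cube:
  fixes a :: "real ^ 'n"
  assumes "0 < l" shows "side (cube a l) = l"
proof -
  have "\<exists>k. 0 < k \<and> (\<exists>b. cube a l = cube b k)"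
    using assms by blast
  then have "0 < side (cube a l) \<and> (\<exists>b. cube a l = cube b (side (cube a l)))"
    unfolding side_def by (rule someI_ex)
  then obtain b where b: "0 < side (cube a l)" "cube a l = cube b (side (cube a l))"
    by blast
  then have "ennreal (l ^ CARD('n)) = ennreal (side (cube a l) ^ CARD('n))"
    using assms by (metis emeasure_cube less_imp_le)
  then show ?thesis
    using assms b(1) by (simp add: power_eq_iff_eq_base)
qed

lemma triple_in_cubes: "Q \<in> cubes \<Longrightarrow> triple Q \<in> cubes"
  by (metis cubesE cube_in_cubes triple_cube mult_pos_pos zero_less_numeral)

lemma subset_triple: "Q \<subseteq> triple Q"
  by (force simp: triple_def)

lemma emeasure_cube_pos: "Q \<in> cubes \<Longrightarrow> 0 < emeasure lebesgue Q"
  by (auto elim!: cubesE simp: emeasure_cube)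

lemma emeasure_cube_finite: "Q \<in> cubes \<Longrightarrow> emeasure lebesgue Q < \<infinity>"
  by (auto elim!: cubesE simp: emeasure_cube)

lemma emeasure_triple:
  fixes Q :: "(real ^ 'n) set"
  assumes "Q \<in> cubes"
  shows "emeasure lebesgue (triple Q) = 3 ^ CARD('n) * emeasure lebesgue Q"
  using assms
  by (auto elim!: cubesE simp: triple_cube emeasure_cube power_mult_distrib ennreal_mult simp flip: ennreal_power)

lemma subset_triple_if_meets:
  fixes P Q :: "(real ^ 'n) set"
  assumes "P \<in> cubes" "Q \<in> cubes" "side Q \<le> side P" "P \<inter> Q \<noteq> {}"
  shows "Q \<subseteq> triple P"
proof -
  obtain a l where P: "P = cube a l" "0 < l" using assms cubesE by metis
  obtain b k where Q: "Q = cube b k" "0 < k" using assms cubesE by metis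
  have "k \<le> l"
    using assms(3) P Q by (simp add: side_cube)
  obtain z where z: "z \<in> cube a l" "z \<in> cube b k"
    using assms P Q by auto
  show ?thesis
  proof
    fix x assume x: "x \<in> Q"
    have "a $ i - l \<le> x $ i \<and> x $ i \<le> a $ i - l + 3 * l" for i
    proof -
      have "a $ i \<le> z $ i" "z $ i \<le> a $ i + l" "b $ i \<le> z $ i" "z $ i \<le> b $ i + k"
        "b $ i \<le> x $ i" "x $ i \<le> b $ i + k"
        using x z unfolding Q(1) mem_cube by blast+
      then show ?thesis
        using \<open>k \<le> l\<close> by linarith
    qed
    then show "x \<in> triple P"
      using P(2) by (simp add: P(1) triple_cube mem_cube)
  qed
qed

section \<open>Selection and covering of cubes\<close>

text \<open>
  Going through \<open>S\<close> by decreasing size, an element is kept unless one kept earlier blocks it by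
  \<open>B\<close>. A sorted list records the order of the selection, which breaks the ties in size. The
  lemma is used with two blocking relations: meeting (Vitali's covering lemma), and meeting
  without a substantial increase of the average (the sparse selection).
\<close>

lemma greedy_selection:
  fixes size :: "'a \<Rightarrow> real" and B :: "'a \<Rightarrow> 'a \<Rightarrow> bool"
  assumes "finite S"
  obtains xs where "distinct xs" "set xs \<subseteq> S"
    "sorted_wrt (\<lambda>P Q. size Q \<le> size P \<and> \<not> B P Q) xs"
    "\<And>Q. Q \<in> S \<Longrightarrow> Q \<in> set xs \<or> (\<exists>P\<in>set xs. size Q \<le> size P \<and> B P Q)"
proof -
  have "\<exists>xs. distinct xs \<and> set xs \<subseteq> S \<and> sorted_wrt (\<lambda>P Q. size Q \<le> size P \<and> \<not> B P Q) xs \<and>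
    (\<forall>Q\<in>S. Q \<in> set xs \<or> (\<exists>P\<in>set xs. size Q \<le> size P \<and> B P Q))"
    using assms
  proof (induction "card S" arbitrary: S)
    case 0
    then show ?case by auto
  next
    case (Suc n)
    then have "S \<noteq> {}" by auto
    then obtain q where q: "q \<in> S" "\<And>P. P \<in> S \<Longrightarrow> size q \<le> size P"
      using Suc.prems by (metis arg_min_if_finite(1) arg_min_least)
    have "n = card (S - {q})"
      using Suc.hyps(2) q(1) by simp
    then obtain xs where xs: "distinct xs" "set xs \<subseteq> S - {q}"
      "sorted_wrt (\<lambda>P Q. size Q \<le> size P \<and> \<not> B P Q) xs"
      "\<forall>Q\<in>S - {q}. Q \<in> set xs \<or> (\<exists>P\<in>set xs. size Q \<le> size P \<and> B P Q)"
      using Suc.hyps(1)[of "S - {q}"] Suc.prems by blast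
    show ?case
    proof (cases "\<exists>P\<in>set xs. B P q")
      case True
      then show ?thesis
        using xs q by (intro exI[of _ xs]) blast
    next
      case False
      have "distinct (xs @ [q])" "set (xs @ [q]) \<subseteq> S"
        using xs q by auto
      moreover have "sorted_wrt (\<lambda>P Q. size Q \<le> size P \<and> \<not> B P Q) (xs @ [q])"
        using xs q False by (auto simp: sorted_wrt_append)
      moreover have "\<forall>Q\<in>S. Q \<in> set (xs @ [q]) \<or>
          (\<exists>P\<in>set (xs @ [q]). size Q \<le> size P \<and> B P Q)"
        using xs(4) by auto
      ultimately show ?thesis by blast
    qed
  qed
  then show ?thesis
    using that by blast
qed

lemma Vitali_cubes:
  fixes S :: "(real ^ 'n) set set"
  assumes "finite S" "S \<subseteq> cubes"
  obtains J where "J \<subseteq> S" "disjoint J" "\<Union>S \<subseteq> (\<Union>P\<in>J. triple P)"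
proof -
  obtain xs where xs: "distinct xs" "set xs \<subseteq> S"
    "sorted_wrt (\<lambda>P Q. side Q \<le> side P \<and> \<not> P \<inter> Q \<noteq> {}) xs"
    "\<And>Q. Q \<in> S \<Longrightarrow> Q \<in> set xs \<or> (\<exists>P\<in>set xs. side Q \<le> side P \<and> P \<inter> Q \<noteq> {})"
    using greedy_selection[OF assms(1), of side "\<lambda>P Q. P \<inter> Q \<noteq> {}"] by blast
  show ?thesis
  proof
    show "set xs \<subseteq> S" by fact
    show "disjoint (set xs)"
    proof (rule disjointI)
      fix P Q assume "P \<in> set xs" "Q \<in> set xs" "P \<noteq> Q"
      then obtain i j where "i < length xs" "j < length xs" "P = xs ! i" "Q = xs ! j" "i \<noteq> j"
        by (metis in_set_conv_nth)
      then show "P \<inter> Q = {}"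
        using sorted_wrt_nth_less[OF xs(3)] by (metis inf_commute linorder_neqE_nat)
    qed
    show "\<Union>S \<subseteq> (\<Union>P\<in>set xs. triple P)"
    proof
      fix x assume "x \<in> \<Union>S"
      then obtain Q where Q: "Q \<in> S" "x \<in> Q" by blast
      from xs(4)[OF Q(1)] show "x \<in> (\<Union>P\<in>set xs. triple P)"
      proof
        assume "Q \<in> set xs"
        then show ?thesis using Q subset_triple by blast
      next
        assume "\<exists>P\<in>set xs. side Q \<le> side P \<and> P \<inter> Q \<noteq> {}"
        then obtain P where P: "P \<in> set xs" "side Q \<le> side P" "P \<inter> Q \<noteq> {}" by blast
        then have "Q \<subseteq> triple P"
          using subset_triple_if_meets[of P Q] assms xs(2) Q(1) by auto
        then show ?thesis using P Q by blast
      qed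
    qed
  qed
qed

text \<open>
  The weak type inequality for a maximal operator over finitely many cubes, in the form that
  compares two measures: the disjoint cubes of the covering lemma carry a fixed proportion of
  \<open>\<mu> (\<Union>S)\<close> because \<open>\<mu>\<close> is doubling, and on each of them \<open>\<nu>\<close> dominates \<open>t \<mu>\<close>.
\<close>

lemma Vitali_weak_type:
  fixes S :: "(real ^ 'n) set set"
  assumes sets: "sets \<mu> = sets lebesgue" "sets \<nu> = sets lebesgue"
    and S: "finite S" "S \<subseteq> cubes"
    and doubling: "\<And>Q. Q \<in> S \<Longrightarrow> emeasure \<mu> (triple Q) \<le> D * emeasure \<mu> Q"
    and large: "\<And>Q. Q \<in> S \<Longrightarrow> t * emeasure \<mu> Q \<le> emeasure \<nu> Q"
  shows "t * emeasure \<mu> (\<Union>S) \<le> D * emeasure \<nu> (\<Union>S)"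
proof -
  obtain J where J: "J \<subseteq> S" "disjoint J" "\<Union>S \<subseteq> (\<Union>P\<in>J. triple P)"
    using Vitali_cubes[OF S] by blast
  have "finite J" "J \<subseteq> cubes"
    using J S finite_subset by auto
  have "emeasure \<mu> (\<Union>S) \<le> emeasure \<mu> (\<Union>P\<in>J. triple P)"
    using J(3) \<open>finite J\<close> \<open>J \<subseteq> cubes\<close> sets_cube[OF triple_in_cubes]
    by (intro emeasure_mono) (auto simp: sets intro!: sets.finite_UN)
  also have "\<dots> \<le> (\<Sum>P\<in>J. emeasure \<mu> (triple P))"
    using \<open>finite J\<close> \<open>J \<subseteq> cubes\<close>
    by (intro emeasure_subadditive_finite) (auto simp: sets intro!: sets_cube triple_in_cubes)
  also have "\<dots> \<le> (\<Sum>P\<in>J. D * emeasure \<mu> P)"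
    using doubling J(1) by (intro sum_mono) auto
  finally have "t * emeasure \<mu> (\<Union>S) \<le> t * (\<Sum>P\<in>J. D * emeasure \<mu> P)"
    by (rule mult_left_mono) simp
  also have "\<dots> = D * (\<Sum>P\<in>J. t * emeasure \<mu> P)"
    by (simp add: sum_distrib_left mult_ac)
  also have "\<dots> \<le> D * (\<Sum>P\<in>J. emeasure \<nu> P)"
    using large J(1) by (intro mult_left_mono sum_mono) auto
  also have "(\<Sum>P\<in>J. emeasure \<nu> P) = emeasure \<nu> (\<Union>J)"
  proof -
    have "(\<lambda>P. P) ` J \<subseteq> sets \<nu>"
      using \<open>J \<subseteq> cubes\<close> sets_cube by (auto simp: sets)
    moreover have "disjoint_family_on (\<lambda>P. P) J"
      using J(2) by (simp add: disjoint_family_on_def disjoint_def)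
    ultimately show ?thesis
      using sum_emeasure[of "\<lambda>P. P" J \<nu>] \<open>finite J\<close> by simp
  qed
  also have "\<dots> \<le> emeasure \<nu> (\<Union>S)"
    using J(1) S by (intro emeasure_mono) (auto simp: sets intro!: sets.finite_Union)
  finally show ?thesis
    by (simp add: mult_left_mono)
qed

section \<open>The maximal operator of a doubling measure\<close>

lemma sigma_finite_lebesgue: "sigma_finite_measure (lebesgue :: 'a::euclidean_space measure)"
proof
  obtain A :: "'a set set" where A: "countable A" "A \<subseteq> sets lborel" "\<Union>A = space lborel"
      "\<forall>a\<in>A. emeasure lborel a \<noteq> \<infinity>"
    using lborel.sigma_finite_countable by blast
  then show "\<exists>A::'a set set. countable A \<and> A \<subseteq> sets lebesgue \<and> \<Union>A = space lebesgue \<and>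
      (\<forall>a\<in>A. emeasure lebesgue a \<noteq> \<infinity>)"
    by (intro exI[of _ A]) (force simp: emeasure_completion)
qed

lemma nn_integral_powr_from_0:
  assumes "-1 < a" "0 \<le> c"
  shows "(\<integral>\<^sup>+t. ennreal (t powr a) * indicator {0..c} t \<partial>lborel) = ennreal (c powr (a + 1) / (a + 1))"
proof -
  have "((\<lambda>x. x powr a) has_integral (c powr (a + 1) / (a + 1))) {0..c}"
    by (rule has_integral_powr_from_0) fact+
  from nn_integral_has_integral_lebesgue'[OF _ this] show ?thesis
    by simp
qed

text \<open>
  Since the sets \<open>E P\<close> are disjoint and contained in the cubes \<open>R P\<close>, the sum is at most the \<open>q\<close>-th
  power of the \<open>L\<^sup>q(s)\<close> norm of a maximal function of \<open>F\<close> with respect to the doubling measure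
  \<open>s dx\<close>. The bound is Marcinkiewicz interpolation between weak type \<open>(1,1)\<close> and the trivial
  estimate in \<open>L\<^sup>\<infinity>\<close>: at height \<open>t\<close> the part of \<open>F\<close> below \<open>t / 2\<close> contributes at most half of an
  average exceeding \<open>t\<close>, so the weak type inequality applies to the part above \<open>t / 2\<close>, and the
  result is integrated against \<open>q t\<^bsup>q-1\<^esup> dt\<close>.
\<close>

lemma maximal_sum_bound:
  fixes s F :: "real ^ 'n \<Rightarrow> ennreal" and R E :: "'b \<Rightarrow> (real ^ 'n) set"
  assumes [measurable]: "s \<in> borel_measurable lebesgue" "F \<in> borel_measurable lebesgue"
    and q: "1 < q" and D: "0 < D"
    and T: "finite T" "\<And>P. P \<in> T \<Longrightarrow> R P \<in> cubes"
    and E: "disjoint_family_on E T" "\<And>P. P \<in> T \<Longrightarrow> E P \<in> sets lebesgue" "\<And>P. P \<in> T \<Longrightarrow> E P \<subseteq> R P"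
  defines "\<mu> \<equiv> density lebesgue s" and "\<nu> \<equiv> density lebesgue (\<lambda>x. F x * s x)"
  assumes doubling: "\<And>P. P \<in> T \<Longrightarrow> emeasure \<mu> (triple (R P)) \<le> ennreal D * emeasure \<mu> (R P)"
    and pos: "\<And>P. P \<in> T \<Longrightarrow> 0 < emeasure \<mu> (R P)"
    and fin: "\<And>P. P \<in> T \<Longrightarrow> emeasure \<mu> (R P) < \<infinity>" "\<And>P. P \<in> T \<Longrightarrow> emeasure \<nu> (R P) < \<infinity>"
  shows "(\<Sum>P\<in>T. emeasure \<mu> (E P) * (emeasure \<nu> (R P) / emeasure \<mu> (R P)) powre q)
    \<le> ennreal (D * q * 2 powr q / (q - 1)) * (\<integral>\<^sup>+x. F x powre q * s x \<partial>lebesgue)"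
proof -
  define \<alpha> where "\<alpha> P = enn2real (emeasure \<nu> (R P) / emeasure \<mu> (R P))" for P
  have \<alpha>: "emeasure \<nu> (R P) / emeasure \<mu> (R P) = ennreal (\<alpha> P)" "0 \<le> \<alpha> P" if "P \<in> T" for P
    using pos[OF that] fin(2)[OF that]
    by (auto simp: \<alpha>_def ennreal_divide_eq_top_iff less_top[symmetric] intro!: ennreal_enn2real[symmetric])
  have sets: "sets \<mu> = sets lebesgue" "sets \<nu> = sets lebesgue"
    by (simp_all add: \<mu>_def \<nu>_def)
  have weak: "ennreal t * (\<Sum>P\<in>{P\<in>T. t \<le> \<alpha> P}. emeasure \<mu> (E P))
      \<le> ennreal (2 * D) * (\<integral>\<^sup>+x. F x * s x * (if ennreal t \<le> 2 * F x then 1 else 0) \<partial>lebesgue)"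
    if "0 < t" for t
  proof -
    define S where "S = {P\<in>T. t \<le> \<alpha> P}"
    have S: "finite S" "R ` S \<subseteq> cubes" "S \<subseteq> T"
      using T by (auto simp: S_def)
    define \<nu>' where "\<nu>' = density lebesgue (\<lambda>x. F x * s x * (if ennreal t \<le> 2 * F x then 1 else 0))"
    have sets': "sets \<nu>' = sets lebesgue"
      by (simp add: \<nu>'_def)
    have large: "ennreal (t / 2) * emeasure \<mu> (R P) \<le> emeasure \<nu>' (R P)" if "P \<in> S" for P
    proof -
      have P: "P \<in> T" "R P \<in> cubes" using that S by auto
      have [measurable]: "R P \<in> sets lebesgue" using P by measurable
      have "ennreal t * emeasure \<mu> (R P) \<le> ennreal (\<alpha> P) * emeasure \<mu> (R P)"
        using that by (intro mult_right_mono) (auto simp: S_def intro!: ennreal_leI)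
      also have "\<dots> = emeasure \<nu> (R P)"
        using pos[OF P(1)] fin(1)[OF P(1)]
        by (simp add: \<alpha>(1)[OF P(1), symmetric] ennreal_divide_times ennreal_times_divide mult_divide_eq_ennreal)
      also have "emeasure \<nu> (R P) = (\<integral>\<^sup>+x. F x * s x * indicator (R P) x \<partial>lebesgue)"
        unfolding \<nu>_def by (rule emeasure_density) measurable
      also have "\<dots> \<le> (\<integral>\<^sup>+x. F x * s x * (if ennreal t \<le> 2 * F x then 1 else 0) * indicator (R P) x
          + ennreal (t / 2) * (s x * indicator (R P) x) \<partial>lebesgue)"
      proof (rule nn_integral_mono)
        fix x
        have "F x \<le> ennreal (t / 2)" if "\<not> ennreal t \<le> 2 * F x"
          using that \<open>0 < t\<close>
          by (cases "F x") (auto simp: ennreal_mult_top not_le ennreal_less_iff ennreal_mult''[symmetric]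
              simp flip: ennreal_numeral ennreal_mult intro!: ennreal_leI)
        then show "F x * s x * indicator (R P) x \<le> F x * s x * (if ennreal t \<le> 2 * F x then 1 else 0) * indicator (R P) x
          + ennreal (t / 2) * (s x * indicator (R P) x)"
          by (auto split: split_indicator intro: mult_right_mono)
      qed
      also have "\<dots> = emeasure \<nu>' (R P) + ennreal (t / 2) * emeasure \<mu> (R P)"
        unfolding \<nu>'_def \<mu>_def
        by (subst nn_integral_add) (auto simp: emeasure_density nn_integral_cmult)
      finally have "ennreal (t / 2) * emeasure \<mu> (R P) + ennreal (t / 2) * emeasure \<mu> (R P)
          \<le> emeasure \<nu>' (R P) + ennreal (t / 2) * emeasure \<mu> (R P)"
        using \<open>0 < t\<close> by (simp flip: distrib_right ennreal_plus)
      then show ?thesis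
        using fin(1)[OF P(1)]
        by (auto simp: ennreal_mult_eq_top_iff add.commute[of "emeasure \<nu>' (R P)"] ennreal_add_left_cancel_le)
    qed
    have "(\<Sum>P\<in>S. emeasure \<mu> (E P)) = emeasure \<mu> (\<Union>P\<in>S. E P)"
      using E S disjoint_family_on_mono[OF S(3)] by (intro sum_emeasure) (auto simp: sets)
    also have "\<dots> \<le> emeasure \<mu> (\<Union>(R ` S))"
    proof (rule emeasure_mono)
      show "(\<Union>P\<in>S. E P) \<subseteq> \<Union>(R ` S)"
        using E(3) S(3) by blast
      show "\<Union>(R ` S) \<in> sets \<mu>"
        unfolding sets using S sets_cube by (intro sets.finite_Union) auto
    qed
    finally have "ennreal (t / 2) * (\<Sum>P\<in>S. emeasure \<mu> (E P)) \<le> ennreal (t / 2) * emeasure \<mu> (\<Union>(R ` S))"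
      by (intro mult_left_mono) auto
    also have "\<dots> \<le> ennreal D * emeasure \<nu>' (\<Union>(R ` S))"
      using S(1,2,3) by (intro Vitali_weak_type) (auto simp: sets sets' intro!: doubling large)
    also have "\<dots> \<le> ennreal D * emeasure \<nu>' UNIV"
      by (intro mult_left_mono emeasure_mono) (auto simp: \<nu>'_def)
    also have "emeasure \<nu>' UNIV = (\<integral>\<^sup>+x. F x * s x * (if ennreal t \<le> 2 * F x then 1 else 0) \<partial>lebesgue)"
      unfolding \<nu>'_def by (subst emeasure_density) (auto simp: mult.assoc)
    finally have "2 * (ennreal (t / 2) * (\<Sum>P\<in>S. emeasure \<mu> (E P))) \<le>
       2 * (ennreal D * (\<integral>\<^sup>+x. F x * s x * (if ennreal t \<le> 2 * F x then 1 else 0) \<partial>lebesgue))"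
      by (rule mult_left_mono) simp
    moreover have "2 * ennreal (t / 2) = ennreal t" "2 * ennreal D = ennreal (2 * D)"
      using \<open>0 < t\<close> D by (simp_all flip: ennreal_numeral ennreal_mult)
    ultimately show ?thesis
      by (simp add: S_def mult.assoc[symmetric])
  qed
  have power: "ennreal (\<alpha> P) powre q = (\<integral>\<^sup>+t. ennreal (q * t powr (q - 1)) * indicator {0..\<alpha> P} t \<partial>lborel)"
    if "P \<in> T" for P
  proof -
    have "ennreal (\<alpha> P) powre q = ennreal q * ennreal (\<alpha> P powr (q - 1 + 1) / (q - 1 + 1))"
      using q \<alpha>(2)[OF that] by (simp add: enn_powr_ennreal flip: ennreal_mult)
    also have "\<dots> = ennreal q * (\<integral>\<^sup>+t. ennreal (t powr (q - 1)) * indicator {0..\<alpha> P} t \<partial>lborel)"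
      using q \<alpha>(2)[OF that] by (subst nn_integral_powr_from_0) auto
    also have "\<dots> = (\<integral>\<^sup>+t. ennreal (q * t powr (q - 1)) * indicator {0..\<alpha> P} t \<partial>lborel)"
      using q by (subst nn_integral_cmult[symmetric]) (auto simp: ennreal_mult mult.assoc)
    finally show ?thesis .
  qed
  have "(\<Sum>P\<in>T. emeasure \<mu> (E P) * (emeasure \<nu> (R P) / emeasure \<mu> (R P)) powre q)
    = (\<Sum>P\<in>T. emeasure \<mu> (E P) * (\<integral>\<^sup>+t. ennreal (q * t powr (q - 1)) * indicator {0..\<alpha> P} t \<partial>lborel))"
    using \<alpha>(1) power by (intro sum.cong) auto
  also have "\<dots> = (\<integral>\<^sup>+t. (\<Sum>P\<in>T. emeasure \<mu> (E P) * (ennreal (q * t powr (q - 1)) * indicator {0..\<alpha> P} t)) \<partial>lborel)"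
    by (subst nn_integral_sum) (auto simp: nn_integral_cmult)
  also have "\<dots> \<le> (\<integral>\<^sup>+t. (\<integral>\<^sup>+x. ennreal (2 * D * q * t powr (q - 2)) * indicator {0..} t *
      (F x * s x * (if ennreal t \<le> 2 * F x then 1 else 0)) \<partial>lebesgue) \<partial>lborel)"
  proof (rule nn_integral_mono)
    fix t :: real
    show "(\<Sum>P\<in>T. emeasure \<mu> (E P) * (ennreal (q * t powr (q - 1)) * indicator {0..\<alpha> P} t))
      \<le> (\<integral>\<^sup>+x. ennreal (2 * D * q * t powr (q - 2)) * indicator {0..} t *
      (F x * s x * (if ennreal t \<le> 2 * F x then 1 else 0)) \<partial>lebesgue)"
    proof (cases "0 < t")
      case True
      have "(\<Sum>P\<in>T. emeasure \<mu> (E P) * (ennreal (q * t powr (q - 1)) * indicator {0..\<alpha> P} t))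
        = (\<Sum>P\<in>{P\<in>T. t \<le> \<alpha> P}. emeasure \<mu> (E P) * ennreal (q * t powr (q - 1)))"
        using T True by (intro sum.mono_neutral_cong_right) auto
      also have "\<dots> = ennreal (q * t powr (q - 2)) * (ennreal t * (\<Sum>P\<in>{P\<in>T. t \<le> \<alpha> P}. emeasure \<mu> (E P)))"
      proof -
        have "q * t powr (q - 1) = q * t powr (q - 2) * t"
          using True powr_add[of t "q - 2" 1] by simp
        then show ?thesis
          using q True by (subst sum_distrib_right[symmetric]) (simp add: ennreal_mult mult_ac)
      qed
      also have "\<dots> \<le> ennreal (q * t powr (q - 2)) *
        (ennreal (2 * D) * (\<integral>\<^sup>+x. F x * s x * (if ennreal t \<le> 2 * F x then 1 else 0) \<partial>lebesgue))"
        by (intro mult_left_mono weak True) simp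
      also have "\<dots> = (\<integral>\<^sup>+x. ennreal (2 * D * q * t powr (q - 2)) * indicator {0..} t *
        (F x * s x * (if ennreal t \<le> 2 * F x then 1 else 0)) \<partial>lebesgue)"
        using q D True by (subst nn_integral_cmult) (auto simp: ennreal_mult mult_ac)
      finally show ?thesis .
    next
      case False
      then have "ennreal (q * t powr (q - 1)) * indicator {0..\<alpha> P} t = 0" for P
        by (cases "t = 0") auto
      then have "(\<Sum>P\<in>T. emeasure \<mu> (E P) * (ennreal (q * t powr (q - 1)) * indicator {0..\<alpha> P} t)) = 0"
        by (intro sum.neutral ballI) (metis mult_zero_right)
      then show ?thesis by simp
    qed
  qed
  \<comment> \<open>Tonelli; the inner integral is then an elementary one over \<open>0 \<le> t \<le> 2 F x\<close>, which
    converges at \<open>0\<close> because \<open>q > 1\<close>.\<close>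
  also have "\<dots> = (\<integral>\<^sup>+x. (\<integral>\<^sup>+t. ennreal (2 * D * q * t powr (q - 2)) * indicator {0..} t *
      (F x * s x * (if ennreal t \<le> 2 * F x then 1 else 0)) \<partial>lborel) \<partial>lebesgue)"
  proof -
    interpret lebesgue: sigma_finite_measure "lebesgue :: (real ^ 'n) measure"
      by (rule sigma_finite_lebesgue)
    interpret pair_sigma_finite "lebesgue :: (real ^ 'n) measure" "lborel :: real measure" ..
    show ?thesis
      by (rule Fubini') measurable
  qed
  also have "\<dots> \<le> (\<integral>\<^sup>+x. ennreal (D * q * 2 powr q / (q - 1)) * (F x powre q * s x) \<partial>lebesgue)"
  proof (rule nn_integral_mono)
    fix x
    show "(\<integral>\<^sup>+t. ennreal (2 * D * q * t powr (q - 2)) * indicator {0..} t *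
      (F x * s x * (if ennreal t \<le> 2 * F x then 1 else 0)) \<partial>lborel)
      \<le> ennreal (D * q * 2 powr q / (q - 1)) * (F x powre q * s x)"
    proof (cases "F x")
      case (real r)
      have "(\<integral>\<^sup>+t. ennreal (2 * D * q * t powr (q - 2)) * indicator {0..} t *
          (F x * s x * (if ennreal t \<le> 2 * F x then 1 else 0)) \<partial>lborel)
        = (\<integral>\<^sup>+t. ennreal (2 * D * q) * (F x * s x) * (ennreal (t powr (q - 2)) * indicator {0..2*r} t) \<partial>lborel)"
        using real q D
        by (intro nn_integral_cong)
           (auto split: split_indicator simp: ennreal_mult mult_ac simp flip: ennreal_numeral ennreal_mult)
      also have "\<dots> = ennreal (2 * D * q) * (F x * s x) * ennreal ((2 * r) powr (q - 1) / (q - 1))"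
        using real q nn_integral_powr_from_0[of "q - 2" "2 * r"] by (subst nn_integral_cmult) auto
      also have "\<dots> = ennreal (2 * D * q) * ennreal r * ennreal ((2 * r) powr (q - 1) / (q - 1)) * s x"
        by (simp only: real mult_ac)
      also have "\<dots> = ennreal (2 * D * q * r * ((2 * r) powr (q - 1) / (q - 1))) * s x"
        using real q D by (subst ennreal_mult[symmetric], simp, simp, subst ennreal_mult[symmetric]) auto
      also have "2 * D * q * r * ((2 * r) powr (q - 1) / (q - 1)) = D * q * 2 powr q / (q - 1) * r powr q"
      proof (cases "r = 0")
        case False
        then have "(2 * r) * (2 * r) powr (q - 1) = 2 powr q * r powr q"
          using real powr_add[of "2 * r" 1 "q - 1"] by (simp add: powr_mult)
        then have "D * q * ((2 * r) * (2 * r) powr (q - 1)) / (q - 1) = D * q * (2 powr q * r powr q) / (q - 1)"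
          by simp
        then show ?thesis by (simp add: mult_ac)
      qed (use q in simp)
      also have "ennreal (D * q * 2 powr q / (q - 1) * r powr q) * s x
        = ennreal (D * q * 2 powr q / (q - 1)) * (F x powre q * s x)"
        using real q D by (subst ennreal_mult) (auto simp: enn_powr_ennreal mult.assoc)
      finally show ?thesis by simp
    next
      case top
      have "0 < D * q * 2 powr q / (q - 1)"
        using q D by simp
      then show ?thesis
        using top q by (cases "s x = 0") (auto simp: ennreal_mult_top ennreal_top_mult ennreal_mult_eq_top_iff)
    qed
  qed
  also have "\<dots> = ennreal (D * q * 2 powr q / (q - 1)) * (\<integral>\<^sup>+x. F x powre q * s x \<partial>lebesgue)"
    by (rule nn_integral_cmult) measurable
  finally show ?thesis .
qed

section \<open>Muckenhoupt weights\<close>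

lemma weight_ennreal:
  assumes "weight v"
  shows "(\<lambda>x. e2ennreal (v x)) \<in> borel_measurable lebesgue"
    and "AE x in lebesgue. 0 < e2ennreal (v x) \<and> e2ennreal (v x) < \<infinity>"
proof -
  have [measurable]: "v \<in> borel_measurable lebesgue"
    using assms by (simp add: weight_def)
  show "(\<lambda>x. e2ennreal (v x)) \<in> borel_measurable lebesgue"
    by measurable
  have "0 < e2ennreal y \<and> e2ennreal y < \<infinity>" if "0 < y \<and> y < \<infinity>" for y
    using that by (cases y) (auto simp: ennreal_less_zero_iff)
  then show "AE x in lebesgue. 0 < e2ennreal (v x) \<and> e2ennreal (v x) < \<infinity>"
    using assms by (auto simp: weight_def elim!: AE_mp)
qed

lemma nn_integral_cube_pos:
  assumes "f \<in> borel_measurable lebesgue" "AE x in lebesgue. 0 < f x" "Q \<in> cubes"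
  shows "0 < (\<integral>\<^sup>+x\<in>Q. f x \<partial>lebesgue)"
proof -
  have [measurable]: "f \<in> borel_measurable lebesgue" "Q \<in> sets lebesgue"
    using assms by auto
  have "\<not> (AE x in lebesgue. f x * indicator Q x = 0)"
  proof
    assume "AE x in lebesgue. f x * indicator Q x = 0"
    with assms(2) have "AE x in lebesgue. x \<notin> Q"
      by eventually_elim (auto split: split_indicator_asm)
    then have "emeasure lebesgue Q = 0"
      by (subst (asm) AE_iff_measurable[of Q]) auto
    then show False
      using emeasure_cube_pos[OF assms(3)] by simp
  qed
  then show ?thesis
    by (subst zero_less_iff_neq_zero, subst nn_integral_0_iff_AE) auto
qed

text \<open>
  A weight in \<open>A\<^sub>q\<close> gives to each subset that fills a fixed proportion of a cube a fixed
  proportion of its mass. The usual proof applies Hoelder's inequality to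
  \<open>1 = s\<^bsup>1/q\<^esup> s\<^bsup>-1/q\<^esup>\<close>; here the pointwise bound \<open>1 \<le> \<tau> s + (\<tau> s)\<^bsup>1-q'\<^esup>\<close> replaces it. It holds
  since one of the two terms is at least \<open>1\<close>, and integrating it over \<open>E\<close> suffices once \<open>\<tau>\<close> is
  chosen so that the second term contributes at most half of the volume of \<open>E\<close>.

  Finiteness and positivity of the mass of a cube come out as well: both averages in the \<open>A\<^sub>q\<close>
  condition are positive, so that boundedness of the product makes both finite.
\<close>

lemma A_infinity_large_subset:
  fixes \<sigma> :: "real ^ 'n \<Rightarrow> ereal" and \<kappa> :: real
  assumes "\<sigma> \<in> A_infinity" and \<kappa>: "1 \<le> \<kappa>"
  defines "\<mu> \<equiv> density lebesgue (\<lambda>x. e2ennreal (\<sigma> x))"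
  obtains K where "0 < K"
    and "\<And>Q E. Q \<in> cubes \<Longrightarrow> E \<in> sets lebesgue \<Longrightarrow> E \<subseteq> Q \<Longrightarrow>
      emeasure lebesgue Q \<le> ennreal \<kappa> * emeasure lebesgue E \<Longrightarrow> emeasure \<mu> Q \<le> ennreal K * emeasure \<mu> E"
    and "\<And>Q. Q \<in> cubes \<Longrightarrow> 0 < emeasure \<mu> Q" "\<And>Q. Q \<in> cubes \<Longrightarrow> emeasure \<mu> Q < \<infinity>"
proof -
  define s where "s x = e2ennreal (\<sigma> x)" for x
  from assms(1) obtain q where q: "1 < q" and w: "weight \<sigma>" and
    A: "(SUP Q\<in>cubes. average Q s * (average Q (\<lambda>x. s x powre (1 - conjugate_exponent q)) powre (q - 1))) < \<infinity>"
    unfolding A_infinity_def A_class_def s_def by auto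
  define r where "r = 1 - conjugate_exponent q"
  have r: "r = - 1 / (q - 1)" "r < 0"
    using q by (auto simp: r_def conjugate_exponent_def field_simps)
  define K where "K = enn2real (SUP Q\<in>cubes. average Q s * (average Q (\<lambda>x. s x powre r) powre (q - 1)))"
  have K: "average Q s * (average Q (\<lambda>x. s x powre r) powre (q - 1)) \<le> ennreal K" if "Q \<in> cubes" for Q
    using A that unfolding K_def r_def[symmetric] by (subst ennreal_enn2real) (auto intro: SUP_upper)
  have "0 \<le> K" by (simp add: K_def)
  have [measurable]: "s \<in> borel_measurable lebesgue"
    unfolding s_def by (rule weight_ennreal[OF w])
  have ae: "AE x in lebesgue. 0 < s x \<and> s x < \<infinity>"
    unfolding s_def by (rule weight_ennreal[OF w])
  have \<mu>: "\<mu> = density lebesgue s"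
    by (simp add: \<mu>_def s_def[abs_def])
  have pos_s: "0 < (\<integral>\<^sup>+x\<in>Q. s x \<partial>lebesgue)" if "Q \<in> cubes" for Q
    using ae that by (intro nn_integral_cube_pos) (auto elim: eventually_mono)
  have pos_r: "0 < (\<integral>\<^sup>+x\<in>Q. s x powre r \<partial>lebesgue)" if "Q \<in> cubes" for Q
  proof (intro nn_integral_cube_pos that)
    show "AE x in lebesgue. 0 < s x powre r"
      using ae by eventually_elim (auto simp: enn_powr_def enn2real_eq_0_iff zero_less_iff_neq_zero)
  qed measurable
  have avg_pos: "0 < average Q s" "0 < average Q (\<lambda>x. s x powre r)" if "Q \<in> cubes" for Q
    using pos_s[OF that] pos_r[OF that] emeasure_cube_finite[OF that]
    by (auto simp: average_def ennreal_zero_less_divide)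
  have avg_fin: "average Q s < \<infinity>" "average Q (\<lambda>x. s x powre r) < \<infinity>" if "Q \<in> cubes" for Q
  proof -
    have "average Q s * (average Q (\<lambda>x. s x powre r) powre (q - 1)) < \<infinity>"
      using K[OF that] by (auto simp: less_top[symmetric] top_unique)
    moreover have "average Q (\<lambda>x. s x powre r) powre (q - 1) \<noteq> 0"
      using avg_pos(2)[OF that] q by simp
    ultimately show "average Q s < \<infinity>" "average Q (\<lambda>x. s x powre r) < \<infinity>"
      using avg_pos(1)[OF that] q by (auto simp: less_top[symmetric] ennreal_mult_eq_top_iff)
  qed
  have mu_avg: "emeasure \<mu> Q = average Q s * emeasure lebesgue Q" if "Q \<in> cubes" for Q
    using that emeasure_cube_pos[OF that] emeasure_cube_finite[OF that]
    by (simp add: \<mu> emeasure_density sets_cube average_def ennreal_divide_times ennreal_times_divide mult_divide_eq_ennreal)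
  have large: "emeasure \<mu> Q \<le> ennreal ((2 * \<kappa>) powr q * (K + 1)) * emeasure \<mu> E"
    if Q: "Q \<in> cubes" and E: "E \<in> sets lebesgue" "E \<subseteq> Q" "emeasure lebesgue Q \<le> ennreal \<kappa> * emeasure lebesgue E" for Q E
  proof -
    have [measurable]: "E \<in> sets lebesgue" "Q \<in> sets lebesgue" using E Q by auto
    define \<omega> where "\<omega> = enn2real (average Q (\<lambda>x. s x powre r))"
    have \<omega>: "average Q (\<lambda>x. s x powre r) = ennreal \<omega>" "0 < \<omega>"
      using avg_pos(2)[OF Q] avg_fin(2)[OF Q] by (auto simp: \<omega>_def enn2real_positive_iff)
    \<comment> \<open>The value for which \<open>\<tau>\<^sup>r\<close> times the integral of \<open>s\<^sup>r\<close> over \<open>Q\<close> is \<open>1 / (2 \<kappa>)\<close> of the volume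
      of \<open>Q\<close>, which is at most half of the volume of \<open>E\<close>.\<close>
    define \<tau> where "\<tau> = (2 * \<kappa> * \<omega>) powr (q - 1)"
    have "0 < \<tau>" using \<omega> \<kappa> by (simp add: \<tau>_def)
    have \<tau>r: "\<tau> powr r = 1 / (2 * \<kappa> * \<omega>)"
      using q \<omega> \<kappa> by (simp add: \<tau>_def powr_powr r(1) powr_minus divide_simps)
    have ptw: "AE x in lebesgue. 1 \<le> ennreal \<tau> * s x + ennreal (1 / (2 * \<kappa> * \<omega>)) * (s x powre r)"
      using ae
    proof eventually_elim
      case (elim x)
      then obtain y where y: "s x = ennreal y" "0 < y"
        by (cases "s x") auto
      have "1 \<le> \<tau> * y + 1 / (2 * \<kappa> * \<omega>) * y powr r"
      proof (cases "1 \<le> \<tau> * y")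
        case True
        then show ?thesis
          using \<omega> \<kappa> by (simp add: add_increasing2)
      next
        case False
        then have "1 powr r \<le> (\<tau> * y) powr r"
          using r(2) \<open>0 < \<tau>\<close> y by (intro powr_mono2') auto
        then show ?thesis
          using \<open>0 < \<tau>\<close> y \<tau>r by (simp add: powr_mult add_increasing)
      qed
      then have "ennreal 1 \<le> ennreal (\<tau> * y + 1 / (2 * \<kappa> * \<omega>) * y powr r)"
        by (rule ennreal_leI)
      also have "\<dots> = ennreal \<tau> * s x + ennreal (1 / (2 * \<kappa> * \<omega>)) * (s x powre r)"
        using y \<open>0 < \<tau>\<close> \<omega> \<kappa> r(2) by (simp add: enn_powr_def flip: ennreal_mult ennreal_plus)
      finally show ?case by simp
    qed
    have "emeasure lebesgue E = (\<integral>\<^sup>+x. 1 * indicator E x \<partial>lebesgue)"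
      by simp
    also have "\<dots> \<le> (\<integral>\<^sup>+x. ennreal \<tau> * (s x * indicator E x) + ennreal (1 / (2 * \<kappa> * \<omega>)) * (s x powre r * indicator Q x) \<partial>lebesgue)"
      using ptw E(2) by (intro nn_integral_mono_AE) (auto elim!: eventually_mono split: split_indicator)
    also have "\<dots> = ennreal \<tau> * emeasure \<mu> E + ennreal (1 / (2 * \<kappa> * \<omega>)) * (\<integral>\<^sup>+x\<in>Q. s x powre r \<partial>lebesgue)"
      by (simp add: nn_integral_add nn_integral_cmult \<mu> emeasure_density)
    also have "(\<integral>\<^sup>+x\<in>Q. s x powre r \<partial>lebesgue) = ennreal \<omega> * emeasure lebesgue Q"
      using emeasure_cube_pos[OF Q] emeasure_cube_finite[OF Q]
      by (simp add: \<omega>(1)[symmetric] average_def ennreal_divide_times ennreal_times_divide mult_divide_eq_ennreal)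
    also have "ennreal (1 / (2 * \<kappa> * \<omega>)) * (ennreal \<omega> * emeasure lebesgue Q) \<le>
       ennreal (1 / (2 * \<kappa> * \<omega>)) * (ennreal \<omega> * (ennreal \<kappa> * emeasure lebesgue E))"
      by (intro mult_left_mono E) auto
    also have "\<dots> = ennreal (1 / 2) * emeasure lebesgue E"
      using \<omega> \<kappa> by (simp flip: ennreal_mult mult.assoc)
    finally have 1: "emeasure lebesgue E \<le> ennreal \<tau> * emeasure \<mu> E + ennreal (1 / 2) * emeasure lebesgue E"
      by (simp add: add_left_mono)
    have fin_E: "emeasure lebesgue E < \<infinity>"
      using emeasure_mono[OF E(2), of lebesgue] emeasure_cube_finite[OF Q] by (auto simp: less_top[symmetric] top_unique)
    have "ennreal (1/2) * emeasure lebesgue E + ennreal (1/2) * emeasure lebesgue E = emeasure lebesgue E"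
    proof -
      have "ennreal (1/2) + ennreal (1/2) = 1"
        by (subst ennreal_plus[symmetric]) auto
      then show ?thesis
        by (metis distrib_right mult_1)
    qed
    with 1 have "ennreal (1/2) * emeasure lebesgue E + ennreal (1/2) * emeasure lebesgue E
         \<le> ennreal (1/2) * emeasure lebesgue E + ennreal \<tau> * emeasure \<mu> E"
      by (simp add: add.commute)
    then have 2: "ennreal (1/2) * emeasure lebesgue E \<le> ennreal \<tau> * emeasure \<mu> E"
      using fin_E by (auto simp: ennreal_add_left_cancel_le ennreal_mult_eq_top_iff)
    have "emeasure \<mu> Q \<le> average Q s * (ennreal \<kappa> * emeasure lebesgue E)"
      unfolding mu_avg[OF Q] by (intro mult_left_mono E) auto
    also have "\<dots> = average Q s * ennreal (2 * \<kappa>) * (ennreal (1/2) * emeasure lebesgue E)"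
    proof -
      have "ennreal \<kappa> = ennreal (2 * \<kappa>) * ennreal (1/2)"
        using \<kappa> by (subst ennreal_mult[symmetric]) auto
      then show ?thesis
        by (metis mult.assoc)
    qed
    also have "\<dots> \<le> average Q s * ennreal (2 * \<kappa>) * (ennreal \<tau> * emeasure \<mu> E)"
      by (intro mult_left_mono 2) auto
    also have "\<dots> = ennreal ((2 * \<kappa>) powr q) * (average Q s * (average Q (\<lambda>x. s x powre r) powre (q - 1))) * emeasure \<mu> E"
    proof -
      have "2 * \<kappa> * \<tau> = (2 * \<kappa>) powr q * \<omega> powr (q - 1)"
        using \<kappa> \<omega> powr_add[of "2 * \<kappa>" 1 "q - 1"] by (simp add: \<tau>_def powr_mult)
      then have "ennreal (2 * \<kappa>) * ennreal \<tau> = ennreal ((2 * \<kappa>) powr q) * (average Q (\<lambda>x. s x powre r) powre (q - 1))"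
        using \<kappa> \<open>0 < \<tau>\<close> \<omega> q by (simp add: enn_powr_ennreal flip: ennreal_mult)
      then have "average Q s * (ennreal (2 * \<kappa>) * ennreal \<tau>) * emeasure \<mu> E = average Q s *
          (ennreal ((2 * \<kappa>) powr q) * (average Q (\<lambda>x. s x powre r) powre (q - 1))) * emeasure \<mu> E"
        by simp
      then show ?thesis by (simp only: mult_ac)
    qed
    also have "\<dots> \<le> ennreal ((2 * \<kappa>) powr q) * ennreal (K + 1) * emeasure \<mu> E"
      using order_trans[OF K[OF Q] ennreal_leI[of K "K + 1"]] by (intro mult_right_mono mult_left_mono) auto
    finally show ?thesis
      using \<open>0 \<le> K\<close> by (simp add: ennreal_mult)
  qed
  show ?thesis
  proof (rule that[OF _ large])
    show "0 < (2 * \<kappa>) powr q * (K + 1)" using \<kappa> \<open>0 \<le> K\<close> by simp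
    show "0 < emeasure \<mu> Q" if "Q \<in> cubes" for Q
      using pos_s[OF that] that by (simp add: \<mu> emeasure_density sets_cube)
    show "emeasure \<mu> Q < \<infinity>" if "Q \<in> cubes" for Q
      using avg_fin[OF that] emeasure_cube_finite[OF that]
      by (simp add: mu_avg[OF that] ennreal_mult_less_top)
  qed
qed

section \<open>Sparse families\<close>

lemma ennreal_inverse_antimono:
  assumes "x \<le> y" shows "inverse y \<le> inverse (x :: ennreal)"
proof (cases "x = 0 \<or> y = top")
  case False
  then obtain r t where "x = ennreal r" "0 < r" "y = ennreal t" "0 < t"
    using assms by (cases x; cases y) (auto simp: top_unique less_le)
  then show ?thesis
    using assms by (simp add: inverse_ennreal le_imp_inverse_le)
qed auto

lemma average_eq_emeasure:
  assumes "g \<in> borel_measurable lebesgue" "Q \<in> cubes"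
  shows "average Q g = emeasure (density lebesgue g) Q / emeasure lebesgue Q"
  using assms by (simp add: average_def emeasure_density sets_cube)

lemma average_times:
  assumes "Q \<in> cubes"
  shows "average Q g * emeasure lebesgue Q = (\<integral>\<^sup>+x\<in>Q. g x \<partial>lebesgue)"
  using emeasure_cube_pos[OF assms] emeasure_cube_finite[OF assms]
  by (simp add: average_def ennreal_divide_times ennreal_times_divide mult_divide_eq_ennreal)

lemma average_le_enlarged:
  fixes Q R :: "(real ^ 'n) set"
  assumes "Q \<in> cubes" "R \<in> cubes" "Q \<subseteq> R" "emeasure lebesgue R \<le> c * emeasure lebesgue Q"
  shows "average Q g \<le> c * average R g"
proof -
  have "average Q g * emeasure lebesgue Q \<le> average R g * emeasure lebesgue R"
    unfolding average_times[OF assms(1)] average_times[OF assms(2)]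
    using assms(3) by (intro nn_integral_mono) (auto split: split_indicator)
  also have "\<dots> \<le> average R g * (c * emeasure lebesgue Q)"
    by (intro mult_left_mono assms) simp
  finally have "emeasure lebesgue Q * average Q g \<le> emeasure lebesgue Q * (c * average R g)"
    by (simp add: mult_ac)
  then show ?thesis
    using emeasure_cube_pos[OF assms(1)] emeasure_cube_finite[OF assms(1)]
    by (simp add: ennreal_mult_le_mult_iff)
qed

lemma average_le_triple:
  fixes Q :: "(real ^ 'n) set"
  assumes "Q \<in> cubes"
  shows "average Q g \<le> 3 ^ CARD('n) * average (triple Q) g"
  using assms by (intro average_le_enlarged triple_in_cubes subset_triple) (auto simp: emeasure_triple)

definition product_average :: "'i set \<Rightarrow> ('i \<Rightarrow> real ^ 'n \<Rightarrow> ennreal) \<Rightarrow> (real ^ 'n) set \<Rightarrow> ennreal" where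
  "product_average I g Q = (\<Prod>i\<in>I. average Q (g i))"

text \<open>
  Among the cubes that contain \<open>Q\<close> the product averages are bounded, since the \<open>g i\<close> are
  integrable and volumes are bounded below. A cube \<open>R\<close> that attains half of the supremum serves,
  as its triple is again one of these cubes.
\<close>

lemma near_maximal_cube:
  fixes g :: "'i \<Rightarrow> real ^ 'n \<Rightarrow> ennreal"
  assumes I: "finite I" and fin: "\<And>i. i \<in> I \<Longrightarrow> (\<integral>\<^sup>+x. g i x \<partial>lebesgue) < \<infinity>"
    and Q: "Q \<in> cubes" "0 < product_average I g Q"
  obtains R where "R \<in> cubes" "Q \<subseteq> R" "product_average I g Q \<le> 2 * product_average I g R"
    "product_average I g (triple R) \<le> 2 * product_average I g R"
proof -
  define s where "s = (SUP R\<in>{R \<in> cubes. Q \<subseteq> R}. product_average I g R)"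
  have upper: "product_average I g R \<le> s" if "R \<in> cubes" "Q \<subseteq> R" for R
    unfolding s_def using that by (intro SUP_upper) auto
  have "s \<le> (\<Prod>i\<in>I. (\<integral>\<^sup>+x. g i x \<partial>lebesgue) / emeasure lebesgue Q)"
    unfolding s_def
  proof (intro SUP_least)
    fix R assume "R \<in> {R \<in> cubes. Q \<subseteq> R}"
    then have R: "R \<in> cubes" "Q \<subseteq> R" by auto
    show "product_average I g R \<le> (\<Prod>i\<in>I. (\<integral>\<^sup>+x. g i x \<partial>lebesgue) / emeasure lebesgue Q)"
      unfolding product_average_def average_def divide_ennreal_def
    proof (intro prod_ennreal_mono mult_mono)
      show "(\<integral>\<^sup>+x\<in>R. g i x \<partial>lebesgue) \<le> (\<integral>\<^sup>+x. g i x \<partial>lebesgue)" for i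
        by (intro nn_integral_mono) (auto split: split_indicator)
      show "inverse (emeasure lebesgue R) \<le> inverse (emeasure lebesgue Q)"
        using R sets_cube by (intro ennreal_inverse_antimono emeasure_mono) auto
    qed auto
  qed
  also have "\<dots> < \<infinity>"
  proof -
    have "(\<integral>\<^sup>+x. g i x \<partial>lebesgue) / emeasure lebesgue Q \<noteq> \<infinity>" if "i \<in> I" for i
      using fin[OF that] emeasure_cube_pos[OF Q(1)] by (auto simp: ennreal_divide_eq_top_iff)
    then show ?thesis
      by (auto simp: less_top[symmetric] ennreal_prod_eq_top)
  qed
  finally have "s < \<infinity>" .
  have "0 < s"
    using Q upper[of Q] by auto
  have "s / 2 < s"
    using \<open>0 < s\<close> \<open>s < \<infinity>\<close>
    by (cases s) (auto simp: ennreal_less_iff divide_ennreal simp flip: ennreal_numeral)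
  then obtain R where R: "R \<in> cubes" "Q \<subseteq> R" "s / 2 < product_average I g R"
    unfolding s_def less_SUP_iff by auto
  have s: "s \<le> 2 * product_average I g R"
  proof -
    have "2 * (s / 2) \<le> 2 * product_average I g R"
      using R(3) by (intro mult_left_mono) auto
    then show ?thesis
      by (simp add: ennreal_times_divide mult.commute[of 2] mult_divide_eq_ennreal)
  qed
  show ?thesis
  proof
    show "product_average I g Q \<le> 2 * product_average I g R"
      using upper[of Q] Q s by auto
    show "product_average I g (triple R) \<le> 2 * product_average I g R"
      using upper[OF triple_in_cubes[OF R(1)]] subset_triple[of R] R(2) s by (meson order_trans)
  qed fact+
qed

text \<open>
  The selected cubes play the role of the stopping cubes of a dyadic grid. A cube is discarded if it meets a
  selected cube \<open>P\<close> that is at least as large and whose product average times \<open>a\<close> is at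
  least its own; such a cube lies in \<open>triple P\<close>.

  If \<open>Q\<close> is selected after \<open>P\<close> and meets it, then \<open>Q \<subseteq> triple P\<close> and the product average over \<open>Q\<close>
  exceeds that over \<open>triple P\<close> by more than the factor \<open>a / 2 = b\<^sup>m\<close>, where \<open>m\<close> is the number of
  functions, because the product average over \<open>P\<close> at most doubles under tripling. Hence for some
  \<open>i\<close> the average of the single function \<open>g i\<close> grows by the factor \<open>b\<close>, and the linear weak type
  inequality on \<open>triple P\<close> bounds the union of all these \<open>Q\<close>. The value \<open>b = 2 m 9\<^sup>n\<close> makes this
  union at most half of \<open>P\<close>, so that removing from \<open>P\<close> everything selected later leaves a set
  \<open>E P\<close> of at least half of the volume; the sets \<open>E P\<close> are disjoint by construction.
\<close>

lemma sparse_selection: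
  fixes g :: "'i \<Rightarrow> real ^ 'n \<Rightarrow> ennreal"
  assumes I: "finite I" "I \<noteq> {}"
    and meas: "\<And>i. i \<in> I \<Longrightarrow> g i \<in> borel_measurable lebesgue"
    and fin: "\<And>i. i \<in> I \<Longrightarrow> (\<integral>\<^sup>+x. g i x \<partial>lebesgue) < \<infinity>"
    and F: "finite F" "F \<subseteq> cubes"
    and pos: "\<And>Q. Q \<in> F \<Longrightarrow> 0 < product_average I g Q"
    and good: "\<And>Q. Q \<in> F \<Longrightarrow> product_average I g (triple Q) \<le> 2 * product_average I g Q"
  defines "a \<equiv> 2 * (2 * of_nat (card I) * 9 ^ CARD('n)) ^ card I :: ennreal"
  obtains T E where "T \<subseteq> F"
    "\<And>Q. Q \<in> F \<Longrightarrow> \<exists>P\<in>T. Q \<subseteq> triple P \<and> product_average I g Q \<le> a * product_average I g P"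
    "disjoint_family_on E T"
    "\<And>P. P \<in> T \<Longrightarrow> E P \<in> sets lebesgue" "\<And>P. P \<in> T \<Longrightarrow> E P \<subseteq> P"
    "\<And>P. P \<in> T \<Longrightarrow> emeasure lebesgue P \<le> 2 * emeasure lebesgue (E P)"
proof -
  define \<Lambda> where "\<Lambda> = product_average I g"
  define b :: ennreal where "b = 2 * of_nat (card I) * 9 ^ CARD('n)"
  have a: "a = 2 * b ^ card I" by (simp add: a_def b_def)
  have card: "0 < card I" using I by (simp add: card_gt_0_iff)
  have b: "0 < b" "b < \<infinity>" "1 \<le> b"
  proof -
    have "b = of_nat (2 * card I * 9 ^ CARD('n))" by (simp add: b_def)
    moreover have "1 \<le> 2 * card I * 9 ^ CARD('n)" using card by simp
    ultimately show "1 \<le> b"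
      by (metis of_nat_1 of_nat_mono)
    then show "0 < b" by (metis less_le_trans zero_less_one)
    show "b < \<infinity>"
      unfolding \<open>b = of_nat _\<close> infinity_ennreal_def by (rule of_nat_less_top)
  qed
  have "1 \<le> a"
    using one_le_power[OF b(3), of "card I"] unfolding a
    by (metis mult_mono one_le_numeral mult_1 zero_le)
  obtain xs where xs: "distinct xs" "set xs \<subseteq> F"
    "sorted_wrt (\<lambda>P Q. side Q \<le> side P \<and> \<not> (P \<inter> Q \<noteq> {} \<and> \<Lambda> Q \<le> a * \<Lambda> P)) xs"
    "\<And>Q. Q \<in> F \<Longrightarrow> Q \<in> set xs \<or> (\<exists>P\<in>set xs. side Q \<le> side P \<and> (P \<inter> Q \<noteq> {} \<and> \<Lambda> Q \<le> a * \<Lambda> P))"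
    using greedy_selection[OF F(1), of side "\<lambda>P Q. P \<inter> Q \<noteq> {} \<and> \<Lambda> Q \<le> a * \<Lambda> P"] by blast
  define later where "later P = {xs ! j | i j. i < j \<and> j < length xs \<and> xs ! i = P}" for P
  define E where "E P = P - \<Union>(later P)" for P
  have later: "later P \<subseteq> set xs" "finite (later P)" "later P \<subseteq> cubes" for P
  proof -
    show "later P \<subseteq> set xs" by (auto simp: later_def)
    then show "finite (later P)" "later P \<subseteq> cubes"
      using xs(2) F by (auto intro: finite_subset)
  qed
  have late: "side Q \<le> side P" "P \<inter> Q \<noteq> {} \<Longrightarrow> a * \<Lambda> P < \<Lambda> Q" if "Q \<in> later P" for P Q
    using that sorted_wrt_nth_less[OF xs(3)] by (force simp: later_def not_le)+
  have half: "2 * emeasure lebesgue (P \<inter> \<Union>(later P)) \<le> emeasure lebesgue P" if "P \<in> set xs" for P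
  proof -
    have P: "P \<in> cubes" "P \<in> F" using that xs(2) F by auto
    have tP: "triple P \<in> cubes" using P by (simp add: triple_in_cubes)
    have avg: "0 < average (triple P) (g i)" "average (triple P) (g i) < \<infinity>" if "i \<in> I" for i
    proof -
      have "average P (g i) \<noteq> 0"
        using pos[OF P(2)] that I by (auto simp: product_average_def zero_less_iff_neq_zero)
      then have "3 ^ CARD('n) * average (triple P) (g i) \<noteq> 0"
        using average_le_triple[OF P(1), of "g i"] by auto
      then show "0 < average (triple P) (g i)"
        by (auto simp: zero_less_iff_neq_zero)
      have "(\<integral>\<^sup>+x\<in>triple P. g i x \<partial>lebesgue) \<le> (\<integral>\<^sup>+x. g i x \<partial>lebesgue)"
        by (intro nn_integral_mono) (auto split: split_indicator)
      then have "(\<integral>\<^sup>+x\<in>triple P. g i x \<partial>lebesgue) \<noteq> \<infinity>"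
        using fin[OF that] by (auto simp: top_unique)
      then show "average (triple P) (g i) < \<infinity>"
        using emeasure_cube_pos[OF tP] by (auto simp: average_def less_top[symmetric] ennreal_divide_eq_top_iff)
    qed
    define S where "S i = {Q \<in> later P. P \<inter> Q \<noteq> {} \<and> b * average (triple P) (g i) \<le> average Q (g i)}" for i
    have S: "finite (S i)" "S i \<subseteq> cubes" for i
      using later(2,3)[of P] by (auto simp: S_def)
    have "P \<inter> \<Union>(later P) \<subseteq> (\<Union>i\<in>I. \<Union>(S i))"
    proof
      fix x assume "x \<in> P \<inter> \<Union>(later P)"
      then obtain Q where Q: "Q \<in> later P" "x \<in> P" "x \<in> Q" by auto
      then have "a * \<Lambda> P < \<Lambda> Q" using late by blast
      moreover have "(\<Prod>i\<in>I. b * average (triple P) (g i)) \<le> a * \<Lambda> P"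
      proof -
        have "(\<Prod>i\<in>I. b * average (triple P) (g i)) = b ^ card I * \<Lambda> (triple P)"
          by (simp add: prod.distrib \<Lambda>_def product_average_def)
        also have "\<dots> \<le> b ^ card I * (2 * \<Lambda> P)"
          using good[OF P(2)] by (intro mult_left_mono) (auto simp: \<Lambda>_def)
        finally show ?thesis by (simp add: a mult_ac)
      qed
      ultimately have "\<not> (\<Prod>i\<in>I. average Q (g i)) \<le> (\<Prod>i\<in>I. b * average (triple P) (g i))"
        by (simp add: \<Lambda>_def product_average_def not_le)
      then obtain i where "i \<in> I" "b * average (triple P) (g i) \<le> average Q (g i)"
        using prod_ennreal_mono[of I "\<lambda>i. average Q (g i)"] by (meson linear)
      then show "x \<in> (\<Union>i\<in>I. \<Union>(S i))"
        using Q by (auto simp: S_def)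
    qed
    then have "emeasure lebesgue (P \<inter> \<Union>(later P)) \<le> emeasure lebesgue (\<Union>i\<in>I. \<Union>(S i))"
      using I S sets_cube by (intro emeasure_mono sets.finite_UN sets.finite_Union) blast+
    also have "\<dots> \<le> (\<Sum>i\<in>I. emeasure lebesgue (\<Union>(S i)))"
      using I S sets_cube by (intro emeasure_subadditive_finite image_subsetI sets.finite_Union) blast+
    finally have "b * emeasure lebesgue (P \<inter> \<Union>(later P)) \<le> b * (\<Sum>i\<in>I. emeasure lebesgue (\<Union>(S i)))"
      by (rule mult_left_mono) simp
    also have "\<dots> = (\<Sum>i\<in>I. b * emeasure lebesgue (\<Union>(S i)))"
      by (simp add: sum_distrib_left)
    also have "\<dots> \<le> (\<Sum>i\<in>I. 9 ^ CARD('n) * emeasure lebesgue P)"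
    proof (rule sum_mono)
      fix i assume i: "i \<in> I"
      define \<nu> where "\<nu> = density lebesgue (g i)"
      have "b * average (triple P) (g i) * emeasure lebesgue (\<Union>(S i)) \<le> 3 ^ CARD('n) * emeasure \<nu> (\<Union>(S i))"
      proof (rule Vitali_weak_type)
        fix Q assume Q: "Q \<in> S i"
        then have "Q \<in> cubes" using S by auto
        then show "emeasure lebesgue (triple Q) \<le> 3 ^ CARD('n) * emeasure lebesgue Q"
          by (simp add: emeasure_triple)
        have "b * average (triple P) (g i) * emeasure lebesgue Q \<le> average Q (g i) * emeasure lebesgue Q"
          using Q by (intro mult_right_mono) (auto simp: S_def)
        also have "\<dots> = emeasure \<nu> Q"
          using \<open>Q \<in> cubes\<close> meas[OF i] by (simp add: average_times \<nu>_def emeasure_density sets_cube)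
        finally show "b * average (triple P) (g i) * emeasure lebesgue Q \<le> emeasure \<nu> Q" .
      qed (use S in \<open>auto simp: \<nu>_def\<close>)
      also have "\<dots> \<le> 3 ^ CARD('n) * emeasure \<nu> (triple P)"
      proof (intro mult_left_mono emeasure_mono)
        show "\<Union>(S i) \<subseteq> triple P"
        proof (rule Union_least)
          fix Q assume "Q \<in> S i"
          then show "Q \<subseteq> triple P"
            using subset_triple_if_meets[of P Q] P(1) later(3)[of P] late(1)[of Q P] by (auto simp: S_def)
        qed
        show "triple P \<in> sets \<nu>"
          using tP sets_cube by (auto simp: \<nu>_def)
      qed simp
      also have "emeasure \<nu> (triple P) = average (triple P) (g i) * (3 ^ CARD('n) * emeasure lebesgue P)"
        using average_times[OF tP, of "g i"] tP meas[OF i] P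
        by (simp add: \<nu>_def emeasure_density sets_cube emeasure_triple)
      also have "3 ^ CARD('n) * (average (triple P) (g i) * (3 ^ CARD('n) * emeasure lebesgue P))
        = average (triple P) (g i) * (9 ^ CARD('n) * emeasure lebesgue P)"
      proof -
        have "(9::ennreal) ^ CARD('n) = 3 ^ CARD('n) * 3 ^ CARD('n)"
          by (simp flip: power_mult_distrib)
        then show ?thesis by (simp add: mult_ac)
      qed
      finally have "average (triple P) (g i) * (b * emeasure lebesgue (\<Union>(S i)))
        \<le> average (triple P) (g i) * (9 ^ CARD('n) * emeasure lebesgue P)"
        by (simp add: mult_ac)
      then show "b * emeasure lebesgue (\<Union>(S i)) \<le> 9 ^ CARD('n) * emeasure lebesgue P"
        using avg[OF i] by (subst (asm) ennreal_mult_le_mult_iff) auto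
    qed
    also have "\<dots> = of_nat (card I) * 9 ^ CARD('n) * emeasure lebesgue P"
      by (simp add: mult.assoc)
    finally have "(of_nat (card I) * 9 ^ CARD('n)) * (2 * emeasure lebesgue (P \<inter> \<Union>(later P)))
        \<le> (of_nat (card I) * 9 ^ CARD('n)) * emeasure lebesgue P"
      by (simp add: b_def mult_ac)
    moreover have "(of_nat (card I) * 9 ^ CARD('n) :: ennreal) \<noteq> 0" "(of_nat (card I) * 9 ^ CARD('n) :: ennreal) \<noteq> top"
      using card I by (auto simp: ennreal_mult_eq_top_iff power_eq_top_ennreal)
    ultimately show ?thesis
      by (subst (asm) ennreal_mult_le_mult_iff) auto
  qed
  show ?thesis
  proof
    show "set xs \<subseteq> F" by fact
    show "\<exists>P\<in>set xs. Q \<subseteq> triple P \<and> product_average I g Q \<le> a * product_average I g P" if Q: "Q \<in> F" for Q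
    proof (cases "Q \<in> set xs")
      case True
      have "1 * product_average I g Q \<le> a * product_average I g Q"
        by (intro mult_right_mono \<open>1 \<le> a\<close>) simp
      with True show ?thesis
        by (intro bexI[of _ Q]) (auto simp: subset_triple)
    next
      case False
      then obtain P where "P \<in> set xs" "side Q \<le> side P" "P \<inter> Q \<noteq> {}" "\<Lambda> Q \<le> a * \<Lambda> P"
        using xs(4)[OF Q] by blast
      then show ?thesis
        using subset_triple_if_meets[of P Q] Q F xs(2) by (intro bexI[of _ P]) (auto simp: \<Lambda>_def)
    qed
    show "disjoint_family_on E (set xs)"
    proof -
      have "E (xs ! i) \<inter> E (xs ! j) = {}" if "i < j" "j < length xs" for i j
        using that by (auto simp: E_def later_def)
      then show ?thesis
        unfolding disjoint_family_on_def by (metis in_set_conv_nth inf_commute linorder_neqE_nat)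
    qed
    fix P assume P: "P \<in> set xs"
    have [measurable]: "P \<in> sets lebesgue" "\<Union>(later P) \<in> sets lebesgue"
      using P xs(2) F later[of P] sets_cube by (auto intro!: sets.finite_Union)
    show "E P \<in> sets lebesgue" by (simp add: E_def)
    show "E P \<subseteq> P" by (auto simp: E_def)
    have "emeasure lebesgue P = emeasure lebesgue (P \<inter> \<Union>(later P)) + emeasure lebesgue (E P)"
      unfolding E_def by (subst plus_emeasure) (auto intro!: arg_cong[where f = "emeasure lebesgue"])
    then have "emeasure lebesgue P + emeasure lebesgue P
      = 2 * emeasure lebesgue (P \<inter> \<Union>(later P)) + 2 * emeasure lebesgue (E P)"
      by (simp add: distrib_left mult_2[symmetric])
    also have "\<dots> \<le> emeasure lebesgue P + 2 * emeasure lebesgue (E P)"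
      using half[OF P] by (rule add_right_mono)
    finally show "emeasure lebesgue P \<le> 2 * emeasure lebesgue (E P)"
      using emeasure_cube_finite[of P] P xs(2) F by (auto simp: ennreal_add_left_cancel_le)
  qed
qed

section \<open>The inequality for finite families of cubes\<close>

lemma enn_le_one_plus_powr:
  assumes "1 \<le> q" shows "y \<le> 1 + y powre q"
proof (cases "y \<le> 1")
  case True
  then show ?thesis by (simp add: add_increasing2)
next
  case False
  then have "y \<le> y powre q"
  proof (cases y)
    case (real r)
    with False have "1 \<le> r" by (simp add: ennreal_le_1)
    then have "r \<le> r powr q"
      using powr_mono[of 1 q r] assms by simp
    then show ?thesis
      using real assms by (simp add: enn_powr_ennreal ennreal_leI)
  qed (use assms in simp)
  then show ?thesis by (simp add: add_increasing)
qed

text \<open>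
  The strong type inequality for the maximal operator over a finite family \<open>F\<close> of cubes, with a
  constant that depends neither on the family nor on the functions. Restricting the functions
  to \<open>\<Union>F\<close> changes no average over a cube of \<open>F\<close> and makes them integrable, so that nearly maximal
  cubes and a sparse subfamily \<open>T\<close> exist. On a cube \<open>triple P\<close> with \<open>P \<in> T\<close>, the average of
  \<open>\<phi> i * s i\<close> is the weighted average \<open>A i P\<close> of \<open>\<phi> i\<close> times the average of \<open>s i\<close>; the testing
  condition absorbs the latter together with the mass of \<open>w\<close>, leaving the masses of
  \<open>triple P\<close>, which the large subset property replaces by the masses of \<open>E P\<close>. Hoelder's
  inequality for the sum over \<open>T\<close> then separates the indices \<open>i\<close>.
\<close>

lemma finite_family_bound:
  fixes s :: "'i \<Rightarrow> real ^ 'n \<Rightarrow> ennreal" and w :: "real ^ 'n \<Rightarrow> ennreal" and ps :: "'i \<Rightarrow> real"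
  assumes I: "finite I" "I \<noteq> {}"
    and s [measurable]: "\<And>i. i \<in> I \<Longrightarrow> s i \<in> borel_measurable lebesgue"
    and w [measurable]: "w \<in> borel_measurable lebesgue"
    and p: "0 < p" "\<And>i. i \<in> I \<Longrightarrow> 1 < ps i" "1 / p = (\<Sum>i\<in>I. 1 / ps i)"
  defines "\<mu> \<equiv> \<lambda>i. density lebesgue (s i)"
  assumes K: "0 < K"
    and large: "\<And>i Q E. i \<in> I \<Longrightarrow> Q \<in> cubes \<Longrightarrow> E \<in> sets lebesgue \<Longrightarrow> E \<subseteq> Q \<Longrightarrow>
      emeasure lebesgue Q \<le> 2 * 3 ^ CARD('n) * emeasure lebesgue E \<Longrightarrow>
      emeasure (\<mu> i) Q \<le> ennreal K * emeasure (\<mu> i) E"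
    and pos: "\<And>i Q. i \<in> I \<Longrightarrow> Q \<in> cubes \<Longrightarrow> 0 < emeasure (\<mu> i) Q"
    and fin: "\<And>i Q. i \<in> I \<Longrightarrow> Q \<in> cubes \<Longrightarrow> emeasure (\<mu> i) Q < \<infinity>"
    and C: "C < \<infinity>"
    and testing: "\<And>Q. Q \<in> cubes \<Longrightarrow> product_average I s Q powre p * (\<integral>\<^sup>+x\<in>Q. w x \<partial>lebesgue)
      \<le> (C * (\<Prod>i\<in>I. emeasure (\<mu> i) Q powre (1 / ps i))) powre p"
  obtains C' where "C' < \<infinity>"
    "\<And>\<phi> F. finite F \<Longrightarrow> F \<subseteq> cubes \<Longrightarrow> (\<And>i. i \<in> I \<Longrightarrow> \<phi> i \<in> borel_measurable lebesgue) \<Longrightarrow>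
      (\<And>i. i \<in> I \<Longrightarrow> (\<integral>\<^sup>+x. \<phi> i x powre ps i * s i x \<partial>lebesgue) < \<infinity>) \<Longrightarrow>
      (\<integral>\<^sup>+x. (SUP Q\<in>F. product_average I (\<lambda>i x. \<phi> i x * s i x) Q * indicator Q x) powre p * w x \<partial>lebesgue)
      \<le> C' * (\<Prod>i\<in>I. (\<integral>\<^sup>+x. \<phi> i x powre ps i * s i x \<partial>lebesgue) powre (p / ps i))"
proof -
  define a :: ennreal where "a = 2 * (2 * of_nat (card I) * 9 ^ CARD('n)) ^ card I"
  define N :: ennreal where "N = (3 ^ CARD('n)) ^ card I"
  define B where "B = (N * C * (\<Prod>i\<in>I. ennreal K powre (1 / ps i))) powre p"
  define c where "c i = ennreal (K * ps i * 2 powr ps i / (ps i - 1))" for i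
  define C' where "C' = (2 * a) powre p * (B * (\<Prod>i\<in>I. c i powre (p / ps i)))"
  have ps: "0 < ps i" "0 < 1 / ps i" "0 < p / ps i" if "i \<in> I" for i
    using p(1) p(2)[OF that] by auto
  have sum_\<theta>: "(\<Sum>i\<in>I. p / ps i) = 1"
  proof -
    have "(\<Sum>i\<in>I. p / ps i) = p * (1 / p)"
      unfolding p(3) by (simp add: sum_distrib_left)
    then show ?thesis using p(1) by simp
  qed
  have "C' < \<infinity>"
  proof -
    have mult: "x * y < top" if "x < top" "y < top" for x y :: ennreal
      using that by (simp add: ennreal_mult_less_top)
    have pow: "x ^ n < top" if "x < top" for x :: ennreal and n
      using that by (simp add: power_less_top_ennreal)
    have card: "(of_nat (card I) :: ennreal) < top"
      by (rule of_nat_less_top)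
    have "2 * a < top" "N < top"
      unfolding a_def N_def
      by (intro mult pow card; simp)+
    moreover have "(\<Prod>i\<in>I. ennreal K powre (1 / ps i)) < top" "(\<Prod>i\<in>I. c i powre (p / ps i)) < top"
      using ps by (auto simp: less_top[symmetric] ennreal_prod_eq_top c_def)
    moreover have "x powre p < top" if "x < top" for x
      using that p(1) by (simp flip: top.not_eq_extremum)
    ultimately show ?thesis
      using C unfolding C'_def B_def by (simp add: ennreal_mult_less_top)
  qed
  have bound: "(\<integral>\<^sup>+x. (SUP Q\<in>F. product_average I (\<lambda>i x. \<phi> i x * s i x) Q * indicator Q x) powre p * w x \<partial>lebesgue)
      \<le> C' * (\<Prod>i\<in>I. (\<integral>\<^sup>+x. \<phi> i x powre ps i * s i x \<partial>lebesgue) powre (p / ps i))"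
    if F: "finite F" "F \<subseteq> cubes"
      and \<phi>[measurable]: "\<And>i. i \<in> I \<Longrightarrow> \<phi> i \<in> borel_measurable lebesgue"
      and \<phi>_fin: "\<And>i. i \<in> I \<Longrightarrow> (\<integral>\<^sup>+x. \<phi> i x powre ps i * s i x \<partial>lebesgue) < \<infinity>" for \<phi> F
  proof -
    define \<phi>' where "\<phi>' i x = \<phi> i x * indicator (\<Union>F) x" for i x
    define g where "g i x = \<phi>' i x * s i x" for i x
    define \<Lambda> where "\<Lambda> = product_average I g"
    define \<nu> where "\<nu> i = density lebesgue (g i)" for i
    have UF [measurable]: "\<Union>F \<in> sets lebesgue"
      using F sets_cube by (intro sets.finite_Union) auto
    have \<phi>' [measurable]: "\<phi>' i \<in> borel_measurable lebesgue" if "i \<in> I" for i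
      unfolding \<phi>'_def using that by measurable
    have g [measurable]: "g i \<in> borel_measurable lebesgue" if "i \<in> I" for i
      unfolding g_def using that by measurable
    have g_fin: "(\<integral>\<^sup>+x. g i x \<partial>lebesgue) < \<infinity>" if i: "i \<in> I" for i
    proof -
      have [measurable]: "s i \<in> borel_measurable lebesgue" "\<phi> i \<in> borel_measurable lebesgue"
        using i by auto
      have "(\<integral>\<^sup>+x. g i x \<partial>lebesgue) \<le> (\<integral>\<^sup>+x. s i x * indicator (\<Union>F) x + \<phi> i x powre ps i * s i x \<partial>lebesgue)"
      proof (rule nn_integral_mono)
        fix x
        have "\<phi> i x * s i x \<le> (1 + \<phi> i x powre ps i) * s i x"
          using enn_le_one_plus_powr[of "ps i" "\<phi> i x"] p(2)[OF i] by (intro mult_right_mono) auto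
        then show "g i x \<le> s i x * indicator (\<Union>F) x + \<phi> i x powre ps i * s i x"
          by (simp add: g_def \<phi>'_def distrib_right split: split_indicator)
      qed
      also have "\<dots> = emeasure (\<mu> i) (\<Union>F) + (\<integral>\<^sup>+x. \<phi> i x powre ps i * s i x \<partial>lebesgue)"
        by (simp add: nn_integral_add \<mu>_def emeasure_density)
      also have "emeasure (\<mu> i) (\<Union>F) \<le> (\<Sum>Q\<in>F. emeasure (\<mu> i) Q)"
        using emeasure_subadditive_finite[of F "\<lambda>Q. Q" "\<mu> i"] F sets_cube by (auto simp: \<mu>_def)
      also have "\<dots> < \<infinity>"
        using fin[OF i] F by (auto simp: ennreal_sum_less_top)
      finally show ?thesis
        using \<phi>_fin[OF i] by (auto simp: add_right_mono less_top[symmetric] top_unique)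
    qed
    have \<Lambda>_eq: "product_average I (\<lambda>i x. \<phi> i x * s i x) Q = \<Lambda> Q" if "Q \<in> F" for Q
      unfolding \<Lambda>_def product_average_def average_def g_def \<phi>'_def using that
      by (intro prod.cong arg_cong2[where f = "(/)"] nn_integral_cong) (auto split: split_indicator)
    define F0 where "F0 = {Q\<in>F. 0 < \<Lambda> Q}"
    have "\<exists>R. R \<in> cubes \<and> Q \<subseteq> R \<and> \<Lambda> Q \<le> 2 * \<Lambda> R \<and> \<Lambda> (triple R) \<le> 2 * \<Lambda> R" if "Q \<in> F0" for Q
    proof -
      have "Q \<in> cubes" "0 < product_average I g Q"
        using that F by (auto simp: F0_def \<Lambda>_def)
      from near_maximal_cube[OF I(1) g_fin this] show ?thesis
        unfolding \<Lambda>_def by metis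
    qed
    then obtain R where R: "\<And>Q. Q \<in> F0 \<Longrightarrow> R Q \<in> cubes" "\<And>Q. Q \<in> F0 \<Longrightarrow> Q \<subseteq> R Q"
      "\<And>Q. Q \<in> F0 \<Longrightarrow> \<Lambda> Q \<le> 2 * \<Lambda> (R Q)" "\<And>Q. Q \<in> F0 \<Longrightarrow> \<Lambda> (triple (R Q)) \<le> 2 * \<Lambda> (R Q)"
      by metis
    have RF: "finite (R ` F0)" "R ` F0 \<subseteq> cubes"
      using F R(1) by (auto simp: F0_def)
    have RF_pos: "0 < product_average I g P" if "P \<in> R ` F0" for P
    proof -
      obtain Q where Q: "Q \<in> F0" "P = R Q" using \<open>P \<in> R ` F0\<close> by blast
      then have "0 < 2 * \<Lambda> P" using R(3)[of Q] by (auto simp: F0_def)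
      then show ?thesis by (auto simp: \<Lambda>_def zero_less_iff_neq_zero)
    qed
    have RF_good: "product_average I g (triple P) \<le> 2 * product_average I g P" if "P \<in> R ` F0" for P
      using that R(4) by (auto simp: \<Lambda>_def)
    obtain T E where T: "T \<subseteq> R ` F0"
      "\<And>Q. Q \<in> R ` F0 \<Longrightarrow> \<exists>P\<in>T. Q \<subseteq> triple P \<and> \<Lambda> Q \<le> a * \<Lambda> P"
      and E: "disjoint_family_on E T"
      "\<And>P. P \<in> T \<Longrightarrow> E P \<in> sets lebesgue" "\<And>P. P \<in> T \<Longrightarrow> E P \<subseteq> P"
      "\<And>P. P \<in> T \<Longrightarrow> emeasure lebesgue P \<le> 2 * emeasure lebesgue (E P)"
      using sparse_selection[where g = g, OF I g g_fin RF RF_pos RF_good] unfolding a_def \<Lambda>_def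
      by metis
    have "finite T" "T \<subseteq> cubes"
      using T(1) RF finite_subset by auto
    have tT: "triple P \<in> cubes" if "P \<in> T" for P
      using that \<open>T \<subseteq> cubes\<close> triple_in_cubes by auto
    have dominated: "(SUP Q\<in>F. product_average I (\<lambda>i x. \<phi> i x * s i x) Q * indicator Q x) powre p
        \<le> (\<Sum>P\<in>T. (2 * a * \<Lambda> P) powre p * indicator (triple P) x)" for x
      unfolding enn_powr_le_iff[OF p(1)]
    proof (rule SUP_least)
      fix Q assume Q: "Q \<in> F"
      show "product_average I (\<lambda>i x. \<phi> i x * s i x) Q * indicator Q x
        \<le> (\<Sum>P\<in>T. (2 * a * \<Lambda> P) powre p * indicator (triple P) x) powre (1 / p)"
      proof (cases "x \<in> Q \<and> 0 < \<Lambda> Q")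
        case True
        then have "Q \<in> F0" using Q by (simp add: F0_def)
        then obtain P where P: "P \<in> T" "R Q \<subseteq> triple P" "\<Lambda> (R Q) \<le> a * \<Lambda> P"
          using T(2) by blast
        have "\<Lambda> Q \<le> 2 * (a * \<Lambda> P)"
          using R(3)[OF \<open>Q \<in> F0\<close>] P(3) by (meson mult_left_mono order_trans zero_le)
        then have "\<Lambda> Q powre p \<le> (2 * a * \<Lambda> P) powre p"
          using p(1) by (intro enn_powr_mono) (auto simp: mult.assoc)
        also have "\<dots> = (2 * a * \<Lambda> P) powre p * indicator (triple P) x"
          using True R(2)[OF \<open>Q \<in> F0\<close>] P(2) by auto
        also have "\<dots> \<le> (\<Sum>P\<in>T. (2 * a * \<Lambda> P) powre p * indicator (triple P) x)"
          using P(1) \<open>finite T\<close> by (intro member_le_sum) auto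
        finally show ?thesis
          using True by (simp add: \<Lambda>_eq[OF Q] enn_powr_le_iff[OF p(1), symmetric])
      qed (auto simp: \<Lambda>_eq[OF Q])
    qed
    define A where "A i P = emeasure (\<nu> i) (triple P) / emeasure (\<mu> i) (triple P)" for i P
    have single: "\<Lambda> P powre p * (\<integral>\<^sup>+x\<in>triple P. w x \<partial>lebesgue)
        \<le> B * (\<Prod>i\<in>I. (emeasure (\<mu> i) (E P) * A i P powre ps i) powre (p / ps i))" if P: "P \<in> T" for P
    proof -
      have Pc: "P \<in> cubes" using P \<open>T \<subseteq> cubes\<close> by auto
      have "\<Lambda> P \<le> (\<Prod>i\<in>I. 3 ^ CARD('n) * average (triple P) (g i))"
        unfolding \<Lambda>_def product_average_def by (intro prod_ennreal_mono average_le_triple Pc)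
      also have "\<dots> = N * (\<Prod>i\<in>I. average (triple P) (g i))"
        by (simp add: prod.distrib N_def)
      also have "(\<Prod>i\<in>I. average (triple P) (g i)) = (\<Prod>i\<in>I. A i P * average (triple P) (s i))"
      proof (rule prod.cong)
        fix i assume i: "i \<in> I"
        show "average (triple P) (g i) = A i P * average (triple P) (s i)"
          using pos[OF i tT[OF P]] fin[OF i tT[OF P]] g[OF i] s[OF i] tT[OF P]
          by (simp add: average_eq_emeasure A_def \<nu>_def \<mu>_def ennreal_times_divide ennreal_divide_times mult_divide_eq_ennreal)
      qed simp
      also have "\<dots> = (\<Prod>i\<in>I. A i P) * product_average I s (triple P)"
        by (simp add: prod.distrib product_average_def)
      finally have "\<Lambda> P powre p \<le> (N * ((\<Prod>i\<in>I. A i P) * product_average I s (triple P))) powre p"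
        by (rule enn_powr_mono[OF p(1)])
      then have "\<Lambda> P powre p * (\<integral>\<^sup>+x\<in>triple P. w x \<partial>lebesgue)
          \<le> (N * ((\<Prod>i\<in>I. A i P) * product_average I s (triple P))) powre p * (\<integral>\<^sup>+x\<in>triple P. w x \<partial>lebesgue)"
        by (rule mult_right_mono) simp
      also have "\<dots> = (N * (\<Prod>i\<in>I. A i P)) powre p *
          (product_average I s (triple P) powre p * (\<integral>\<^sup>+x\<in>triple P. w x \<partial>lebesgue))"
        by (simp add: enn_powr_mult p(1) mult_ac)
      also have "\<dots> \<le> (N * (\<Prod>i\<in>I. A i P)) powre p *
          (C * (\<Prod>i\<in>I. emeasure (\<mu> i) (triple P) powre (1 / ps i))) powre p"
        by (intro mult_left_mono testing tT P) simp
      also have "\<dots> = (N * C * (\<Prod>i\<in>I. A i P * emeasure (\<mu> i) (triple P) powre (1 / ps i))) powre p"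
        by (simp add: enn_powr_mult[OF p(1), symmetric] prod.distrib mult_ac)
      also have "\<dots> \<le> (N * C * (\<Prod>i\<in>I. A i P * (ennreal K * emeasure (\<mu> i) (E P)) powre (1 / ps i))) powre p"
      proof (intro enn_powr_mono p(1) mult_left_mono prod_ennreal_mono)
        fix i assume i: "i \<in> I"
        have "emeasure lebesgue (triple P) \<le> 3 ^ CARD('n) * (2 * emeasure lebesgue (E P))"
          unfolding emeasure_triple[OF Pc] by (intro mult_left_mono E P) simp
        moreover have "E P \<subseteq> triple P"
          using E(3)[OF P] subset_triple by blast
        ultimately show "emeasure (\<mu> i) (triple P) \<le> ennreal K * emeasure (\<mu> i) (E P)"
          using i tT[OF P] E(2)[OF P] by (intro large) (auto simp: mult_ac)
        show "0 < 1 / ps i" by (rule ps[OF i])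
      qed auto
      also have "\<dots> = (N * C * (\<Prod>i\<in>I. ennreal K powre (1 / ps i)) *
          (\<Prod>i\<in>I. A i P * emeasure (\<mu> i) (E P) powre (1 / ps i))) powre p"
      proof -
        have "(\<Prod>i\<in>I. A i P * (ennreal K * emeasure (\<mu> i) (E P)) powre (1 / ps i))
          = (\<Prod>i\<in>I. ennreal K powre (1 / ps i) * (A i P * emeasure (\<mu> i) (E P) powre (1 / ps i)))"
          by (intro prod.cong) (auto simp: enn_powr_mult ps mult_ac)
        then show ?thesis
          by (simp add: prod.distrib mult_ac)
      qed
      also have "\<dots> = B * (\<Prod>i\<in>I. (A i P * emeasure (\<mu> i) (E P) powre (1 / ps i)) powre p)"
        by (simp add: B_def enn_powr_mult[OF p(1)] enn_powr_prod[OF p(1)])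
      also have "(\<Prod>i\<in>I. (A i P * emeasure (\<mu> i) (E P) powre (1 / ps i)) powre p)
         = (\<Prod>i\<in>I. (emeasure (\<mu> i) (E P) * A i P powre ps i) powre (p / ps i))"
      proof (intro prod.cong refl)
        fix i assume i: "i \<in> I"
        have "ps i \<noteq> 0" using ps(1)[OF i] by simp
        then show "(A i P * emeasure (\<mu> i) (E P) powre (1 / ps i)) powre p
            = (emeasure (\<mu> i) (E P) * A i P powre ps i) powre (p / ps i)"
          using p(1) ps[OF i] by (simp add: enn_powr_mult enn_powr_powr mult.commute)
      qed
      finally show ?thesis .
    qed
    have maximal: "(\<Sum>P\<in>T. emeasure (\<mu> i) (E P) * A i P powre ps i)
        \<le> c i * (\<integral>\<^sup>+x. \<phi> i x powre ps i * s i x \<partial>lebesgue)" if i: "i \<in> I" for i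
    proof -
      have "(\<Sum>P\<in>T. emeasure (\<mu> i) (E P) * A i P powre ps i) \<le> c i * (\<integral>\<^sup>+x. \<phi>' i x powre ps i * s i x \<partial>lebesgue)"
        unfolding A_def c_def \<mu>_def \<nu>_def g_def
      proof (rule maximal_sum_bound)
        fix P assume P: "P \<in> T"
        show "E P \<subseteq> triple P" using E(3)[OF P] subset_triple by blast
        show "emeasure (density lebesgue (s i)) (triple (triple P))
            \<le> ennreal K * emeasure (density lebesgue (s i)) (triple P)"
        proof (rule large[OF i, unfolded \<mu>_def])
          have "1 * (3 ^ CARD('n) * emeasure lebesgue (triple P)) \<le> 2 * (3 ^ CARD('n) * emeasure lebesgue (triple P))"
            by (intro mult_right_mono) auto
          then show "emeasure lebesgue (triple (triple P)) \<le> 2 * 3 ^ CARD('n) * emeasure lebesgue (triple P)"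
            unfolding emeasure_triple[OF tT[OF P]] by (simp add: mult.assoc)
        qed (use tT[OF P] triple_in_cubes sets_cube subset_triple in auto)
        show "emeasure (density lebesgue (\<lambda>x. \<phi>' i x * s i x)) (triple P) < \<infinity>"
        proof -
          have "emeasure (\<nu> i) (triple P) \<le> (\<integral>\<^sup>+x. g i x \<partial>lebesgue)"
            using g[OF i] sets_cube[OF tT[OF P]] unfolding \<nu>_def
            by (subst emeasure_density) (auto intro!: nn_integral_mono split: split_indicator)
          also note g_fin[OF i]
          finally show ?thesis by (simp add: \<nu>_def g_def[abs_def])
        qed
      qed (use i E p(2) K pos fin tT \<open>finite T\<close> s \<phi>' in \<open>auto simp: \<mu>_def\<close>)
      also have "\<dots> \<le> c i * (\<integral>\<^sup>+x. \<phi> i x powre ps i * s i x \<partial>lebesgue)"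
        using ps(1)[OF i] by (intro mult_left_mono nn_integral_mono mult_right_mono enn_powr_mono)
          (auto simp: \<phi>'_def split: split_indicator)
      finally show ?thesis .
    qed
    have "(\<integral>\<^sup>+x. (SUP Q\<in>F. product_average I (\<lambda>i x. \<phi> i x * s i x) Q * indicator Q x) powre p * w x \<partial>lebesgue)
      \<le> (\<integral>\<^sup>+x. (\<Sum>P\<in>T. (2 * a * \<Lambda> P) powre p * indicator (triple P) x) * w x \<partial>lebesgue)"
      by (intro nn_integral_mono mult_right_mono dominated) simp
    also have "\<dots> = (\<integral>\<^sup>+x. (\<Sum>P\<in>T. (2 * a * \<Lambda> P) powre p * (w x * indicator (triple P) x)) \<partial>lebesgue)"
      unfolding sum_distrib_right by (simp only: mult_ac)
    also have "\<dots> = (\<Sum>P\<in>T. (2 * a * \<Lambda> P) powre p * (\<integral>\<^sup>+x\<in>triple P. w x \<partial>lebesgue))"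
      using sets_cube[OF tT] by (subst nn_integral_sum) (auto simp: nn_integral_cmult)
    also have "\<dots> = (\<Sum>P\<in>T. (2 * a) powre p * (\<Lambda> P powre p * (\<integral>\<^sup>+x\<in>triple P. w x \<partial>lebesgue)))"
      by (simp add: enn_powr_mult[OF p(1)] mult.assoc)
    also have "\<dots> \<le> (\<Sum>P\<in>T. (2 * a) powre p *
        (B * (\<Prod>i\<in>I. (emeasure (\<mu> i) (E P) * A i P powre ps i) powre (p / ps i))))"
      by (intro sum_mono mult_left_mono single) auto
    also have "\<dots> = (2 * a) powre p *
        (B * (\<Sum>P\<in>T. \<Prod>i\<in>I. (emeasure (\<mu> i) (E P) * A i P powre ps i) powre (p / ps i)))"
      by (simp add: sum_distrib_left)
    also have "\<dots> \<le> (2 * a) powre p *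
        (B * (\<Prod>i\<in>I. (\<Sum>P\<in>T. emeasure (\<mu> i) (E P) * A i P powre ps i) powre (p / ps i)))"
      using ps(3) by (intro mult_left_mono Holder_sum_prod I sum_\<theta> \<open>finite T\<close>) auto
    also have "\<dots> \<le> (2 * a) powre p *
        (B * (\<Prod>i\<in>I. (c i * (\<integral>\<^sup>+x. \<phi> i x powre ps i * s i x \<partial>lebesgue)) powre (p / ps i)))"
      using ps(3) by (intro mult_left_mono prod_ennreal_mono enn_powr_mono maximal) auto
    also have "(\<Prod>i\<in>I. (c i * (\<integral>\<^sup>+x. \<phi> i x powre ps i * s i x \<partial>lebesgue)) powre (p / ps i))
      = (\<Prod>i\<in>I. c i powre (p / ps i)) * (\<Prod>i\<in>I. (\<integral>\<^sup>+x. \<phi> i x powre ps i * s i x \<partial>lebesgue) powre (p / ps i))"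
      unfolding prod.distrib[symmetric] using ps(3) by (intro prod.cong enn_powr_mult) auto
    finally show ?thesis
      by (simp add: C'_def mult.assoc)
  qed
  show ?thesis
    by (rule that[OF \<open>C' < \<infinity>\<close> bound])
qed

section \<open>Rational cubes\<close>

definition rational_cubes :: "(real ^ 'n) set set" where
  "rational_cubes = {cube a l | a l. (\<forall>i. a $ i \<in> \<rat>) \<and> l \<in> \<rat> \<and> 0 < l}"

lemma countable_rational_cubes: "countable (rational_cubes :: (real ^ 'n) set set)"
proof -
  have "countable ({a :: real ^ 'n. \<forall>i. a $ i \<in> \<rat>} \<times> (\<rat> :: real set))"
    by (intro countable_SIGMA countable_rat countable_vector)
  then have "countable ((\<lambda>(a, l). cube a l) ` ({a :: real ^ 'n. \<forall>i. a $ i \<in> \<rat>} \<times> (\<rat> :: real set)))"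
    by (rule countable_image)
  then show ?thesis
    by (rule countable_subset[rotated]) (auto simp: rational_cubes_def)
qed

lemma rational_cubes_subset: "rational_cubes \<subseteq> cubes"
  by (auto simp: rational_cubes_def cube_in_cubes)

text \<open>
  Rational cubes make the supremum countable, which gives measurability and monotone convergence.
  Enclosing a cube costs a bounded factor in volume, which is harmless for an inequality with an
  unspecified constant.
\<close>

lemma enclosing_rational_cube:
  fixes Q :: "(real ^ 'n) set"
  assumes "Q \<in> cubes"
  obtains R where "R \<in> rational_cubes" "Q \<subseteq> R" "emeasure lebesgue R \<le> 2 ^ CARD('n) * emeasure lebesgue Q"
proof -
  obtain b k where Q: "Q = cube b k" "0 < k" using assms cubesE by metis
  have "\<exists>y\<in>\<rat>. b $ i - k / 4 < y \<and> y < b $ i" for i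
    using Q(2) by (intro Rats_dense_in_real) simp
  then obtain f where f: "\<And>i. f i \<in> \<rat>" "\<And>i. b $ i - k / 4 < f i" "\<And>i. f i < b $ i"
    by metis
  obtain l where l: "l \<in> \<rat>" "5 * k / 4 < l" "l < 2 * k"
    using Rats_dense_in_real[of "5 * k / 4" "2 * k"] Q(2) by auto
  have "0 < l" using l Q(2) by linarith
  show ?thesis
  proof
    show "cube (\<chi> i. f i) l \<in> rational_cubes"
      using f(1) l(1) \<open>0 < l\<close> by (auto simp: rational_cubes_def intro!: exI[of _ "\<chi> i. f i"])
    show "Q \<subseteq> cube (\<chi> i. f i) l"
    proof
      fix x assume x: "x \<in> Q"
      have "f i \<le> x $ i \<and> x $ i \<le> f i + l" for i
      proof -
        have "b $ i \<le> x $ i" "x $ i \<le> b $ i + k"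
          using x by (auto simp: Q(1) mem_cube)
        then show ?thesis
          using f(2)[of i] f(3)[of i] l(2) by linarith
      qed
      then show "x \<in> cube (\<chi> i. f i) l"
        by (simp add: mem_cube)
    qed
    have "ennreal (l ^ CARD('n)) \<le> ennreal ((2 * k) ^ CARD('n))"
      using l \<open>0 < l\<close> by (intro ennreal_leI power_mono) auto
    also have "\<dots> = 2 ^ CARD('n) * ennreal (k ^ CARD('n))"
      using Q(2) by (simp add: power_mult_distrib ennreal_mult flip: ennreal_power)
    finally show "emeasure lebesgue (cube (\<chi> i. f i :: real ^ 'n) l) \<le> 2 ^ CARD('n) * emeasure lebesgue Q"
      using Q \<open>0 < l\<close> by (simp add: emeasure_cube)
  qed
qed

lemma product_average_rational:
  fixes Q :: "(real ^ 'n) set" and g :: "'i \<Rightarrow> real ^ 'n \<Rightarrow> ennreal"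
  assumes "Q \<in> cubes"
  obtains R where "R \<in> rational_cubes" "Q \<subseteq> R"
    "product_average I g Q \<le> (2 ^ CARD('n)) ^ card I * product_average I g R"
proof -
  obtain R where R: "R \<in> rational_cubes" "Q \<subseteq> R" "emeasure lebesgue R \<le> 2 ^ CARD('n) * emeasure lebesgue Q"
    using enclosing_rational_cube[OF assms] .
  have Rc: "R \<in> cubes" using R(1) rational_cubes_subset by auto
  have "average Q h \<le> 2 ^ CARD('n) * average R h" for h
    using assms Rc R(2,3) by (rule average_le_enlarged)
  then have "product_average I g Q \<le> (\<Prod>i\<in>I. 2 ^ CARD('n) * average R (g i))"
    unfolding product_average_def by (intro prod_ennreal_mono)
  then show ?thesis
    using that[OF R(1,2)] by (simp add: product_average_def prod.distrib)
qed

section \<open>The testing condition and the strong type inequality\<close>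

text \<open>
  On \<open>Q\<close> the maximal function of the \<open>\<sigma> i\<close> restricted to \<open>Q\<close> is at least the product of their averages over \<open>Q\<close> itself.
\<close>

lemma testing_condition_average:
  fixes u :: "real ^ 'n \<Rightarrow> ereal" and \<sigma> :: "nat \<Rightarrow> real ^ 'n \<Rightarrow> ereal"
  assumes test: "testing_condition m p ps u \<sigma>" and p: "0 < p" and u: "weight u"
  obtains C :: real where "\<And>Q. Q \<in> cubes \<Longrightarrow>
      product_average {1..m} (\<lambda>i x. e2ennreal (\<sigma> i x)) Q powre p * (\<integral>\<^sup>+x\<in>Q. e2ennreal (u x) \<partial>lebesgue)
      \<le> (ennreal C * (\<Prod>i=1..m. weight_measure (\<sigma> i) Q powre (1 / ps i))) powre p"
proof -
  obtain C :: real where C: "\<And>Q. Q \<in> cubes \<Longrightarrow>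
      (\<integral>\<^sup>+x\<in>Q. (e2ennreal (multilinear_maximal m (\<lambda>i y. \<sigma> i y * indicator Q y) x) powre p)
                 * e2ennreal (u x) \<partial>lebesgue) powre (1 / p)
      \<le> ennreal C * (\<Prod>i=1..m. weight_measure (\<sigma> i) Q powre (1 / ps i))"
    using test unfolding testing_condition_def by blast
  show ?thesis
  proof (rule that)
    fix Q :: "(real ^ 'n) set" assume Q: "Q \<in> cubes"
    define c where "c = product_average {1..m} (\<lambda>i x. e2ennreal (\<sigma> i x)) Q"
    let ?M = "\<lambda>x. e2ennreal (multilinear_maximal m (\<lambda>i y. \<sigma> i y * indicator Q y) x)"
    have M: "c \<le> ?M x" if "x \<in> Q" for x
    proof -
      have "c \<le> (\<Prod>i=1..m. average Q (\<lambda>y. e2ennreal \<bar>\<sigma> i y * indicator Q y\<bar>))"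
        unfolding c_def product_average_def average_def
      proof (intro prod_ennreal_mono divide_right_mono_ennreal nn_integral_mono)
        fix i y
        have "\<sigma> i y \<le> \<bar>\<sigma> i y\<bar>" by (cases "\<sigma> i y") auto
        then show "e2ennreal (\<sigma> i y) * indicator Q y \<le> e2ennreal \<bar>\<sigma> i y * indicator Q y\<bar> * indicator Q y"
          by (cases "y \<in> Q") (auto intro: e2ennreal_mono)
      qed
      also have "\<dots> \<le> ?M x"
        using Q that by (auto simp: multilinear_maximal_def intro!: SUP_upper)
      finally show ?thesis .
    qed
    have "c powre p * (\<integral>\<^sup>+x\<in>Q. e2ennreal (u x) \<partial>lebesgue) = (\<integral>\<^sup>+x\<in>Q. c powre p * e2ennreal (u x) \<partial>lebesgue)"
      using weight_ennreal(1)[OF u] sets_cube[OF Q]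
      by (subst nn_integral_cmult[symmetric]) (auto simp: mult.assoc)
    also have "\<dots> \<le> (\<integral>\<^sup>+x\<in>Q. ?M x powre p * e2ennreal (u x) \<partial>lebesgue)"
      using M p by (intro nn_integral_mono) (auto split: split_indicator intro!: mult_right_mono enn_powr_mono)
    also have "\<dots> \<le> (ennreal C * (\<Prod>i=1..m. weight_measure (\<sigma> i) Q powre (1 / ps i))) powre p"
      using C[OF Q] p by (simp add: enn_powr_le_iff)
    finally show "c powre p * (\<integral>\<^sup>+x\<in>Q. e2ennreal (u x) \<partial>lebesgue)
      \<le> (ennreal C * (\<Prod>i=1..m. weight_measure (\<sigma> i) Q powre (1 / ps i))) powre p" .
  qed
qed

lemma e2ennreal_abs_mult: "e2ennreal \<bar>x * y\<bar> = e2ennreal \<bar>x\<bar> * e2ennreal \<bar>y\<bar>"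
proof -
  have "enn2ereal (e2ennreal \<bar>x\<bar> * e2ennreal \<bar>y\<bar>) = \<bar>x * y\<bar>"
    by (simp add: times_ennreal.rep_eq enn2ereal_e2ennreal ereal_abs_mult)
  then show ?thesis
    by (metis e2ennreal_enn2ereal)
qed

theorem theorem1p9:
  fixes m :: nat and p :: real and ps :: "nat \<Rightarrow> real"
    and u :: "real ^ 'n \<Rightarrow> ereal" and \<sigma> :: "nat \<Rightarrow> real ^ 'n \<Rightarrow> ereal"
  assumes "m > 0"
    and "weight u"
    and "\<forall>i\<in>{1..m}. weight (\<sigma> i)"
    and "\<forall>i\<in>{1..m}. 1 < ps i"
    and "1 / p = (\<Sum>i=1..m. 1 / ps i)"
    and "\<forall>i\<in>{1..m}. \<sigma> i \<in> A_infinity"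
    and "testing_condition m p ps u \<sigma>"
  shows "\<exists>C::real. \<forall>f. (\<forall>i\<in>{1..m}. f i \<in> Lspace (ps i) (\<sigma> i)) \<longrightarrow>
    Lnorm p u (multilinear_maximal m (\<lambda>i x. f i x * \<sigma> i x))
      \<le> ennreal C * (\<Prod>i=1..m. Lnorm (ps i) (\<sigma> i) (f i))"
proof -
  define I where "I = {1..m}"
  define s where "s i x = e2ennreal (\<sigma> i x)" for i x
  define w where "w x = e2ennreal (u x)" for x
  define \<mu> where "\<mu> i = density lebesgue (s i)" for i
  have I: "finite I" "I \<noteq> {}" using assms(1) by (auto simp: I_def)
  have s [measurable]: "s i \<in> borel_measurable lebesgue" if "i \<in> I" for i
    using assms(3) that weight_ennreal(1)[of "\<sigma> i"] by (auto simp: s_def[abs_def] I_def)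
  have w [measurable]: "w \<in> borel_measurable lebesgue"
    using assms(2) weight_ennreal(1)[of u] by (simp add: w_def[abs_def])
  have ps: "1 < ps i" if "i \<in> I" for i using assms(4) that by (auto simp: I_def)
  have sum_p: "1 / p = (\<Sum>i\<in>I. 1 / ps i)" using assms(5) by (simp add: I_def)
  have p: "0 < p"
  proof -
    have "0 < (\<Sum>i\<in>I. 1 / ps i)"
      using ps I by (intro sum_pos) force+
    then show ?thesis using sum_p by (metis zero_less_divide_1_iff)
  qed
  define doubling where "doubling i K \<longleftrightarrow> 0 < K \<and>
      (\<forall>Q E. Q \<in> cubes \<longrightarrow> E \<in> sets lebesgue \<longrightarrow> E \<subseteq> Q \<longrightarrow>
        emeasure lebesgue Q \<le> 2 * 3 ^ CARD('n) * emeasure lebesgue E \<longrightarrow>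
        emeasure (\<mu> i) Q \<le> ennreal K * emeasure (\<mu> i) E) \<and>
      (\<forall>Q\<in>cubes. 0 < emeasure (\<mu> i) Q \<and> emeasure (\<mu> i) Q < \<infinity>)" for i K
  have "\<exists>K. doubling i K" if i: "i \<in> I" for i
  proof -
    have A: "\<sigma> i \<in> A_infinity" using assms(6) i by (auto simp: I_def)
    have \<kappa>: "1 \<le> (2 * 3 ^ CARD('n) :: real)"
      using one_le_power[of "3::real" "CARD('n)"] by linarith
    have eq: "ennreal (2 * 3 ^ CARD('n)) = 2 * 3 ^ CARD('n)"
      by (simp add: ennreal_mult flip: ennreal_power)
    show ?thesis
      using A_infinity_large_subset[OF A \<kappa>] unfolding doubling_def eq \<mu>_def s_def[abs_def] by metis
  qed
  then obtain K where K_all: "doubling i (K i)" if "i \<in> I" for i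
    by metis
  have K: "0 < K i" if "i \<in> I" for i
    using K_all that unfolding doubling_def by blast
  have large: "emeasure (\<mu> i) Q \<le> ennreal (K i) * emeasure (\<mu> i) E"
    if "i \<in> I" "Q \<in> cubes" "E \<in> sets lebesgue" "E \<subseteq> Q"
        "emeasure lebesgue Q \<le> 2 * 3 ^ CARD('n) * emeasure lebesgue E" for i Q E
    using K_all that unfolding doubling_def by blast
  have pos: "0 < emeasure (\<mu> i) Q" and fin: "emeasure (\<mu> i) Q < \<infinity>" if "i \<in> I" "Q \<in> cubes" for i Q
    using K_all that unfolding doubling_def by blast+
  define K' where "K' = Max (K ` I)"
  have K': "K i \<le> K'" if "i \<in> I" for i
    using that I by (simp add: K'_def)
  have "0 < K'"
    using I K K' by (metis all_not_in_conv less_le_trans)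
  have large': "emeasure (\<mu> i) Q \<le> ennreal K' * emeasure (\<mu> i) E"
    if "i \<in> I" "Q \<in> cubes" "E \<in> sets lebesgue" "E \<subseteq> Q"
        "emeasure lebesgue Q \<le> 2 * 3 ^ CARD('n) * emeasure lebesgue E" for i Q E
    using large[OF that] K'[OF that(1)] by (meson ennreal_leI mult_right_mono order_trans zero_le)
  have weight_\<mu>: "weight_measure (\<sigma> i) Q = emeasure (\<mu> i) Q" if "i \<in> I" "Q \<in> cubes" for i Q
    using that s[OF that(1)] sets_cube[OF that(2)]
    by (simp add: weight_measure_def \<mu>_def emeasure_density s_def)
  obtain Ct :: real where Ct: "\<And>Q. Q \<in> cubes \<Longrightarrow>
      product_average I s Q powre p * (\<integral>\<^sup>+x\<in>Q. w x \<partial>lebesgue)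
      \<le> (ennreal Ct * (\<Prod>i\<in>I. emeasure (\<mu> i) Q powre (1 / ps i))) powre p"
  proof (rule testing_condition_average[OF assms(7) p assms(2)])
    fix C :: real
    assume "\<And>Q. Q \<in> cubes \<Longrightarrow>
      product_average {1..m} (\<lambda>i x. e2ennreal (\<sigma> i x)) Q powre p * (\<integral>\<^sup>+x\<in>Q. e2ennreal (u x) \<partial>lebesgue)
      \<le> (ennreal C * (\<Prod>i=1..m. weight_measure (\<sigma> i) Q powre (1 / ps i))) powre p"
    then show thesis
      using weight_\<mu> by (intro that[of C]) (simp add: I_def s_def[abs_def] w_def)
  qed
  obtain C' where C': "C' < \<infinity>"
    and bound: "\<And>\<phi> F. finite F \<Longrightarrow> F \<subseteq> cubes \<Longrightarrow> (\<And>i. i \<in> I \<Longrightarrow> \<phi> i \<in> borel_measurable lebesgue) \<Longrightarrow>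
      (\<And>i. i \<in> I \<Longrightarrow> (\<integral>\<^sup>+x. \<phi> i x powre ps i * s i x \<partial>lebesgue) < \<infinity>) \<Longrightarrow>
      (\<integral>\<^sup>+x. (SUP Q\<in>F. product_average I (\<lambda>i x. \<phi> i x * s i x) Q * indicator Q x) powre p * w x \<partial>lebesgue)
      \<le> C' * (\<Prod>i\<in>I. (\<integral>\<^sup>+x. \<phi> i x powre ps i * s i x \<partial>lebesgue) powre (p / ps i))"
  proof (rule finite_family_bound[OF I s w p ps sum_p \<open>0 < K'\<close> large'[unfolded \<mu>_def]
        pos[unfolded \<mu>_def] fin[unfolded \<mu>_def] _ Ct[unfolded \<mu>_def]])
    show "ennreal Ct < \<infinity>" by simp
  next
    fix C' :: ennreal
    assume "C' < \<infinity>" and "\<And>\<phi> F. finite F \<Longrightarrow> F \<subseteq> cubes \<Longrightarrow>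
      (\<And>i. i \<in> I \<Longrightarrow> \<phi> i \<in> borel_measurable lebesgue) \<Longrightarrow>
      (\<And>i. i \<in> I \<Longrightarrow> (\<integral>\<^sup>+x. \<phi> i x powre ps i * s i x \<partial>lebesgue) < \<infinity>) \<Longrightarrow>
      (\<integral>\<^sup>+x. (SUP Q\<in>F. product_average I (\<lambda>i x. \<phi> i x * s i x) Q * indicator Q x) powre p * w x \<partial>lebesgue)
      \<le> C' * (\<Prod>i\<in>I. (\<integral>\<^sup>+x. \<phi> i x powre ps i * s i x \<partial>lebesgue) powre (p / ps i))"
    then show thesis by (rule that)
  qed
  define d :: ennreal where "d = (2 ^ CARD('n)) ^ card I"
  define C where "C = (d powre p * C') powre (1 / p)"
  have "C < \<infinity>"
  proof -
    have "d < top" by (simp add: d_def power_less_top_ennreal)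
    then have "d powre p < top"
      using p by (simp flip: top.not_eq_extremum)
    then have "d powre p * C' < top"
      using C' by (simp add: ennreal_mult_less_top)
    then show ?thesis
      using p by (simp add: C_def flip: top.not_eq_extremum)
  qed
  have main: "Lnorm p u (multilinear_maximal m (\<lambda>i x. f i x * \<sigma> i x))
      \<le> C * (\<Prod>i\<in>I. Lnorm (ps i) (\<sigma> i) (f i))" if f: "\<forall>i\<in>I. f i \<in> Lspace (ps i) (\<sigma> i)" for f
  proof -
    define \<phi> where "\<phi> i x = e2ennreal \<bar>f i x\<bar>" for i x
    define X where "X i = (\<integral>\<^sup>+x. \<phi> i x powre ps i * s i x \<partial>lebesgue)" for i
    define \<Lambda> where "\<Lambda> = product_average I (\<lambda>i x. \<phi> i x * s i x)"
    define M where "M x = (SUP Q\<in>{Q \<in> cubes. x \<in> Q}. \<Lambda> Q)" for x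
    have \<phi> [measurable]: "\<phi> i \<in> borel_measurable lebesgue" if "i \<in> I" for i
    proof -
      have [measurable]: "f i \<in> borel_measurable lebesgue" using f that by (auto simp: Lspace_def)
      show ?thesis unfolding \<phi>_def by measurable
    qed
    have Lnorm_f: "Lnorm (ps i) (\<sigma> i) (f i) = X i powre (1 / ps i)" for i
      by (simp add: Lnorm_def X_def \<phi>_def s_def)
    have X: "X i < \<infinity>" if "i \<in> I" for i
    proof -
      have "X i powre (1 / ps i) < top"
        using f that Lnorm_f[of i] by (auto simp: Lspace_def)
      then show ?thesis using ps[OF that] by (simp flip: top.not_eq_extremum)
    qed
    have M_eq: "e2ennreal \<bar>multilinear_maximal m (\<lambda>i x. f i x * \<sigma> i x) x\<bar> = M x" for x
    proof -
      have "average Q (\<lambda>y. e2ennreal \<bar>f i y * \<sigma> i y\<bar>) = average Q (\<lambda>y. \<phi> i y * s i y)" if "i \<in> I" for i Q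
      proof -
        have "weight (\<sigma> i)" using assms(3) that by (auto simp: I_def)
        then have "AE y in lebesgue. 0 < \<sigma> i y"
          unfolding weight_def by (auto elim: eventually_mono)
        then have "AE y in lebesgue. e2ennreal \<bar>f i y * \<sigma> i y\<bar> * indicator Q y = \<phi> i y * s i y * indicator Q y"
          by eventually_elim (simp add: e2ennreal_abs_mult \<phi>_def s_def)
        then show ?thesis
          unfolding average_def by (simp cong: nn_integral_cong_AE)
      qed
      then show ?thesis
        unfolding multilinear_maximal_def M_def \<Lambda>_def product_average_def I_def[symmetric]
        by (simp cong: prod.cong)
    qed
    \<comment> \<open>An increasing sequence of finite families exhausts the rational cubes.\<close>
    define G where "G k = from_nat_into (rational_cubes :: (real ^ 'n) set set) ` {..k}" for k :: nat
    define h where "h k x = (SUP Q\<in>G k. \<Lambda> Q * indicator Q x)" for k x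
    have ne: "(rational_cubes :: (real ^ 'n) set set) \<noteq> {}"
      using enclosing_rational_cube[OF cube_in_cubes[of 1 "0 :: real ^ 'n"]] by auto
    have G: "finite (G k)" "G k \<subseteq> cubes" for k
      using from_nat_into[OF ne] rational_cubes_subset by (auto simp: G_def)
    have M_le: "M x powre p \<le> d powre p * (SUP k. h k x powre p)" for x
    proof -
      have "M x \<le> d * ((SUP k. h k x powre p) powre (1 / p))"
        unfolding M_def
      proof (rule SUP_least)
        fix Q assume "Q \<in> {Q \<in> cubes. x \<in> Q}"
        then have Q: "Q \<in> cubes" "x \<in> Q" by auto
        obtain R where R: "R \<in> rational_cubes" "Q \<subseteq> R" "\<Lambda> Q \<le> d * \<Lambda> R"
          using product_average_rational[OF Q(1), of I "\<lambda>i x. \<phi> i x * s i x"]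
          unfolding \<Lambda>_def d_def by blast
        obtain k where k: "R = from_nat_into rational_cubes k"
          using from_nat_into_surj[OF countable_rational_cubes R(1)] by metis
        have "\<Lambda> R = \<Lambda> R * indicator R x"
          using Q R by auto
        also have "\<dots> \<le> h k x"
          unfolding h_def by (intro SUP_upper) (simp add: G_def k)
        finally have "\<Lambda> R powre p \<le> (SUP k. h k x powre p)"
          using p by (meson SUP_upper2 UNIV_I enn_powr_mono)
        then have "\<Lambda> R \<le> (SUP k. h k x powre p) powre (1 / p)"
          using p by (simp add: enn_powr_le_iff)
        then show "\<Lambda> Q \<le> d * ((SUP k. h k x powre p) powre (1 / p))"
          using R(3) by (meson mult_left_mono order_trans zero_le)
      qed
      then have "M x powre p \<le> (d * ((SUP k. h k x powre p) powre (1 / p))) powre p"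
        by (rule enn_powr_mono[OF p])
      then show ?thesis
        using p by (simp add: enn_powr_mult enn_powr_powr)
    qed
    have h_meas [measurable]: "h k \<in> borel_measurable lebesgue" for k
      unfolding h_def using G[of k] sets_cube by (intro borel_measurable_SUP countable_finite) auto
    have "(\<integral>\<^sup>+x. M x powre p * w x \<partial>lebesgue) \<le> (\<integral>\<^sup>+x. d powre p * (SUP k. h k x powre p * w x) \<partial>lebesgue)"
      using mult_right_mono[OF M_le] by (intro nn_integral_mono) (simp add: SUP_mult_right_ennreal mult.assoc)
    also have "\<dots> = d powre p * (\<integral>\<^sup>+x. (SUP k. h k x powre p * w x) \<partial>lebesgue)"
      by (rule nn_integral_cmult) measurable
    also have "(\<integral>\<^sup>+x. (SUP k. h k x powre p * w x) \<partial>lebesgue) = (SUP k. \<integral>\<^sup>+x. h k x powre p * w x \<partial>lebesgue)"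
    proof (rule nn_integral_monotone_convergence_SUP)
      have "h k x \<le> h l x" if "k \<le> l" for k l x
        unfolding h_def G_def using that by (intro SUP_subset_mono image_mono) auto
      then show "incseq (\<lambda>k x. h k x powre p * w x)"
        using p by (auto simp: incseq_def le_fun_def intro!: mult_right_mono enn_powr_mono)
    qed measurable
    also have "\<dots> \<le> C' * (\<Prod>i\<in>I. X i powre (p / ps i))"
      unfolding h_def \<Lambda>_def X_def
      by (intro SUP_least bound G \<phi> X[unfolded X_def])
    finally have "(\<integral>\<^sup>+x. M x powre p * w x \<partial>lebesgue) \<le> d powre p * (C' * (\<Prod>i\<in>I. X i powre (p / ps i)))"
      by (simp add: mult_left_mono)
    then have "(\<integral>\<^sup>+x. M x powre p * w x \<partial>lebesgue) powre (1 / p)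
        \<le> (d powre p * C' * (\<Prod>i\<in>I. X i powre (p / ps i))) powre (1 / p)"
      using p by (intro enn_powr_mono) (auto simp: mult.assoc)
    also have "\<dots> = C * (\<Prod>i\<in>I. (X i powre (p / ps i)) powre (1 / p))"
      using p by (simp add: enn_powr_mult enn_powr_prod C_def)
    also have "(\<Prod>i\<in>I. (X i powre (p / ps i)) powre (1 / p)) = (\<Prod>i\<in>I. Lnorm (ps i) (\<sigma> i) (f i))"
      unfolding Lnorm_f
    proof (intro prod.cong refl)
      fix i assume "i \<in> I"
      then have "0 < ps i" using ps by force
      then show "(X i powre (p / ps i)) powre (1 / p) = X i powre (1 / ps i)"
        using p by (simp add: enn_powr_powr)
    qed
    finally show ?thesis
      by (simp add: Lnorm_def M_eq w_def)
  qed
  have "ennreal (enn2real C) = C"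
    using \<open>C < \<infinity>\<close> by simp
  then show ?thesis
    using main unfolding I_def by (intro exI[of _ "enn2real C"]) simp
qed

end
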